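(* Let $\mathbb{P}$ be generated by a PLSEM with DAG $D$ and edge functions $f_{j,i}$, and suppose $\mathbb{P}$ is faithful to $D$. Fix a node $i$ such that the functions in $\{f_{j',i}'':\ j'\text{ a child of }i\text{ in }D\text{ with }f_{j',i}\text{ nonlinear}\}$ are linearly independent. Fix $k\neq i$. Then $k$ is a descendant of $i$ in the DAG $D'$ of every PLSEM that generates $\mathbb{P}$ if and only if $k$ is a descendant in $D$ of some child $j'$ of $i$ with $f_{j',i}$ nonlinear.
   Context: A PLSEM with DAG $D$ on $\{1,\dots,p\}$ is a system $X_j=\mu_j+\sum_{i\in\mathrm{pa}_D(j)} f_{j,i}(X_i)+\varepsilon_j$, $j=1,\dots,p$, where $\mu_j\in\mathbb{R}$, $f_{j,i}\in C^2(\mathbb{R})$, $f_{j,i}\not\equiv 0$, $\mathbb{E}[f_{j,i}(X_i)]=0$, and $\varepsilon_1,\dots,\varepsilon_p$ are mutually independent with $\varepsilon_j\sim\mathcal{N}(0,\sigma_j^2)$, $\sigma_j^2>0$; the distribution of the solution $X$ is said to be generated by the PLSEM. A function $f_{j,i}$ is nonlinear if $f_{j,i}''\not\equiv 0$. $\mathbb{P}$ is faithful to $D$ if the conditional independences in $\mathbb{P}$ are exactly those implied by d-separation in $D$. A node $k$ is a descendant of $i$ if $k$ can be reached from $i$ along directed edges; every node is a descendant of itself. Faithfulness of $\mathbb{P}$ to $D'$ is not assumed. *)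

theory Defs
  imports "HOL-Probability.Probability"
begin

text \<open>A directed graph on nodes {1..p} is an edge relation D, where D u v means u -> v.\<close>

definition is_dag :: "nat \<Rightarrow> (nat \<Rightarrow> nat \<Rightarrow> bool) \<Rightarrow> bool" where
  "is_dag p D \<longleftrightarrow> (\<forall>u v. D u v \<longrightarrow> u \<in> {1..p} \<and> v \<in> {1..p}) \<and> (\<forall>u. \<not> D\<^sup>+\<^sup>+ u u)"

definition descendant :: "(nat \<Rightarrow> nat \<Rightarrow> bool) \<Rightarrow> nat \<Rightarrow> nat \<Rightarrow> bool" where
  "descendant D i k \<longleftrightarrow> D\<^sup>*\<^sup>* i k"

definition adjacent :: "(nat \<Rightarrow> nat \<Rightarrow> bool) \<Rightarrow> nat \<Rightarrow> nat \<Rightarrow> bool" where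
  "adjacent D u v \<longleftrightarrow> D u v \<or> D v u"

definition is_path :: "nat \<Rightarrow> (nat \<Rightarrow> nat \<Rightarrow> bool) \<Rightarrow> nat list \<Rightarrow> bool" where
  "is_path p D ps \<longleftrightarrow> ps \<noteq> [] \<and> distinct ps \<and> set ps \<subseteq> {1..p} \<and>
     (\<forall>n. Suc n < length ps \<longrightarrow> adjacent D (ps ! n) (ps ! Suc n))"

definition collider :: "(nat \<Rightarrow> nat \<Rightarrow> bool) \<Rightarrow> nat list \<Rightarrow> nat \<Rightarrow> bool" where
  "collider D ps n \<longleftrightarrow> D (ps ! (n - 1)) (ps ! n) \<and> D (ps ! Suc n) (ps ! n)"

definition blocked :: "(nat \<Rightarrow> nat \<Rightarrow> bool) \<Rightarrow> nat list \<Rightarrow> nat set \<Rightarrow> bool" where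
  "blocked D ps C \<longleftrightarrow> (\<exists>n. 0 < n \<and> Suc n < length ps \<and>
      ((\<not> collider D ps n \<and> ps ! n \<in> C) \<or>
       (collider D ps n \<and> (\<forall>w \<in> C. \<not> descendant D (ps ! n) w))))"

definition d_separated :: "nat \<Rightarrow> (nat \<Rightarrow> nat \<Rightarrow> bool) \<Rightarrow> nat set \<Rightarrow> nat set \<Rightarrow> nat set \<Rightarrow> bool" where
  "d_separated p D A B C \<longleftrightarrow>
     (\<forall>ps. is_path p D ps \<and> hd ps \<in> A \<and> last ps \<in> B \<longrightarrow> blocked D ps C)"

definition coord_sigma :: "(nat \<Rightarrow> real) measure \<Rightarrow> nat set \<Rightarrow> (nat \<Rightarrow> real) measure" where
  "coord_sigma P C = vimage_algebra (space P) (\<lambda>x. restrict x C) (PiM C (\<lambda>_. borel))"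

definition cond_indep :: "(nat \<Rightarrow> real) measure \<Rightarrow> nat set \<Rightarrow> nat set \<Rightarrow> nat set \<Rightarrow> bool" where
  "cond_indep P A B C \<longleftrightarrow>
     (\<forall>S \<in> sets (PiM A (\<lambda>_. borel)). \<forall>T \<in> sets (PiM B (\<lambda>_. borel)).
        AE x in P.
          real_cond_exp P (coord_sigma P C)
             (\<lambda>y. indicator S (restrict y A) * indicator T (restrict y B)) x
          = real_cond_exp P (coord_sigma P C) (\<lambda>y. indicator S (restrict y A)) x
            * real_cond_exp P (coord_sigma P C) (\<lambda>y. indicator T (restrict y B)) x)"

definition faithful :: "nat \<Rightarrow> (nat \<Rightarrow> real) measure \<Rightarrow> (nat \<Rightarrow> nat \<Rightarrow> bool) \<Rightarrow> bool" where
  "faithful p P D \<longleftrightarrow>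
     (\<forall>A B C. A \<subseteq> {1..p} \<and> B \<subseteq> {1..p} \<and> C \<subseteq> {1..p} \<and> A \<noteq> {} \<and> B \<noteq> {} \<and>
        A \<inter> B = {} \<and> A \<inter> C = {} \<and> B \<inter> C = {} \<longrightarrow>
        (cond_indep P A B C \<longleftrightarrow> d_separated p D A B C))"

definition C2 :: "(real \<Rightarrow> real) \<Rightarrow> bool" where
  "C2 g \<longleftrightarrow> (\<forall>x. g differentiable at x) \<and> (\<forall>x. deriv g differentiable at x) \<and>
            continuous_on UNIV (deriv (deriv g))"

definition nonlinear :: "(real \<Rightarrow> real) \<Rightarrow> bool" where
  "nonlinear g \<longleftrightarrow> deriv (deriv g) \<noteq> (\<lambda>_. 0)"

text \<open>Canonical noise space: independent eps_j ~ N(0, sigma2 j), j in {1..p}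
  (sigma2 j is the variance; normal_density takes the standard deviation).\<close>
definition noise_space :: "nat \<Rightarrow> (nat \<Rightarrow> real) \<Rightarrow> (nat \<Rightarrow> real) measure" where
  "noise_space p sigma2 = PiM {1..p} (\<lambda>j. density lborel (normal_density 0 (sqrt (sigma2 j))))"

text \<open>P is generated by the PLSEM with DAG D, intercepts mu, edge functions f
  (f j i is the function on edge i -> j) and noise variances sigma2.\<close>
definition generates ::
  "nat \<Rightarrow> (nat \<Rightarrow> real) measure \<Rightarrow> (nat \<Rightarrow> nat \<Rightarrow> bool) \<Rightarrow> (nat \<Rightarrow> real)
     \<Rightarrow> (nat \<Rightarrow> nat \<Rightarrow> real \<Rightarrow> real) \<Rightarrow> (nat \<Rightarrow> real) \<Rightarrow> bool" where
  "generates p P D mu f sigma2 \<longleftrightarrow>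
     is_dag p D \<and> (\<forall>j \<in> {1..p}. sigma2 j > 0) \<and>
     (\<forall>i j. D i j \<longrightarrow> C2 (f j i) \<and> f j i \<noteq> (\<lambda>_. 0)) \<and>
     (\<exists>X :: (nat \<Rightarrow> real) \<Rightarrow> nat \<Rightarrow> real.
        (\<lambda>e. restrict (X e) {1..p}) \<in> measurable (noise_space p sigma2) (PiM {1..p} (\<lambda>_. borel)) \<and>
        (\<forall>e \<in> space (noise_space p sigma2). \<forall>j \<in> {1..p}.
            X e j = mu j + (\<Sum>i \<in> {i. D i j}. f j i (X e i)) + e j) \<and>
        (\<forall>i j. D i j \<longrightarrow> integrable (noise_space p sigma2) (\<lambda>e. f j i (X e i)) \<and>
                         (\<integral>e. f j i (X e i) \<partial>noise_space p sigma2) = 0) \<and>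
        P = distr (noise_space p sigma2) (PiM {1..p} (\<lambda>_. borel)) (\<lambda>e. restrict (X e) {1..p}))"

definition lin_indep_family :: "nat set \<Rightarrow> (nat \<Rightarrow> real \<Rightarrow> real) \<Rightarrow> bool" where
  "lin_indep_family S g \<longleftrightarrow>
     (\<forall>c. (\<forall>x. (\<Sum>j \<in> S. c j * g j x) = 0) \<longrightarrow> (\<forall>j \<in> S. c j = 0))"

end

theory Submission
  imports Defs
begin

text \<open>Let \<open>r\<close> and \<open>r'\<close> be the residuals (noises as functions of \<open>x\<close>) of two PLSEMs with the same law.
  The log-densities agree up to a constant, so the weighted sums of squares of \<open>r\<close> and \<open>r'\<close> do too.
  Peeling off the sinks of \<open>D'\<close> one by one and differentiating twice in the sink variable shows that
  every \<open>r' l\<close> is a linear combination of the \<open>r b\<close> with constant coefficients.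

  If \<open>k\<close> is not a descendant of \<open>i\<close> in \<open>D'\<close>, linear independence forces the residuals of the
  non-descendants of \<open>i\<close> in \<open>D'\<close> to avoid \<open>r j\<close> for every nonlinear child \<open>j\<close> of \<open>i\<close>, so \<open>X k\<close> is a
  function of the noises other than that of \<open>j\<close>. Then \<open>X j\<close> and \<open>X k\<close> are conditionally independent
  given the non-descendants of \<open>j\<close>, which faithfulness excludes when \<open>k\<close> is a descendant of \<open>j\<close>.

  Conversely, if no nonlinear child of \<open>i\<close> leads to \<open>k\<close>, the remaining descendants of \<open>i\<close> can directly
  follow \<open>i\<close> in a causal order; \<open>i\<close> is then moved past each of them by rotating two Gaussian noises,
  which needs only that the edge from \<open>i\<close> is linear.\<close>

section \<open>Solving the structural equations\<close>

text \<open>The sum runs over all of \<open>I\<close>: an absent edge is encoded as the zero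
  function, so no graph appears.\<close>

definition resid :: "nat set \<Rightarrow> (nat \<Rightarrow> real) \<Rightarrow> (nat \<Rightarrow> nat \<Rightarrow> real \<Rightarrow> real) \<Rightarrow> nat \<Rightarrow> (nat \<Rightarrow> real) \<Rightarrow> real" where
  "resid I mu f j x = x j - mu j - (\<Sum>i\<in>I. f j i (x i))"

definition joint_density :: "nat set \<Rightarrow> (nat \<Rightarrow> real) \<Rightarrow> (nat \<Rightarrow> nat \<Rightarrow> real \<Rightarrow> real) \<Rightarrow> (nat \<Rightarrow> real) \<Rightarrow> (nat \<Rightarrow> real) \<Rightarrow> real" where
  "joint_density I mu f s2 x = (\<Prod>j\<in>I. normal_density 0 (sqrt (s2 j)) (resid I mu f j x))"

text \<open>\<open>f a b\<close> sits on the edge from \<open>b\<close> to \<open>a\<close>, so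
  \<open>sorted_wrt\<close> excludes edges from later to earlier nodes; the last clause excludes
  loops.\<close>

definition causal_order :: "nat list \<Rightarrow> (nat \<Rightarrow> nat \<Rightarrow> real \<Rightarrow> real) \<Rightarrow> bool" where
  "causal_order xs f \<longleftrightarrow> distinct xs \<and> sorted_wrt (\<lambda>a b. f a b = (\<lambda>_. 0)) xs \<and> (\<forall>a\<in>set xs. f a a = (\<lambda>_. 0))"

abbreviation normal_noise :: "(nat \<Rightarrow> real) \<Rightarrow> nat \<Rightarrow> real measure" where
  "normal_noise s2 j \<equiv> density lborel (\<lambda>t. ennreal (normal_density 0 (sqrt (s2 j)) t))"

lemma joint_density_nonneg: "0 \<le> joint_density I mu f s2 x"
  unfolding joint_density_def by (intro prod_nonneg) auto

lemma measurable_PiM_coordinate: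
  assumes "i \<in> I" "g \<in> borel_measurable borel"
  shows "(\<lambda>x. g (x i)) \<in> borel_measurable (PiM I (\<lambda>_. borel))"
  by (rule measurable_compose[OF measurable_component_singleton[OF assms(1)] assms(2)])

lemma resid_measurable:
  assumes "j \<in> I" "\<And>i. i \<in> I \<Longrightarrow> f j i \<in> borel_measurable borel"
  shows "resid I mu f j \<in> borel_measurable (PiM I (\<lambda>_. borel))"
  unfolding resid_def[abs_def]
  using assms by (intro borel_measurable_diff borel_measurable_sum borel_measurable_const measurable_component_singleton
      measurable_PiM_coordinate) auto

lemma joint_density_measurable:
  assumes "\<And>i j. i \<in> I \<Longrightarrow> j \<in> I \<Longrightarrow> f j i \<in> borel_measurable borel"
  shows "joint_density I mu f s2 \<in> borel_measurable (PiM I (\<lambda>_. borel))"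
  unfolding joint_density_def[abs_def]
  using assms by (intro borel_measurable_prod measurable_compose[OF resid_measurable]) auto

lemma product_sigma_finite_normal_noise: "product_sigma_finite (normal_noise s2)"
  by (intro product_sigma_finite.intro) (simp add: sigma_finite_measure.sigma_finite_iff_density_finite[OF sigma_finite_lborel])

lemma product_sigma_finite_lborel: "product_sigma_finite (\<lambda>_::nat. lborel :: real measure)"
  by (intro product_sigma_finite.intro) (rule sigma_finite_lborel)

lemma sets_PiM_lborel: "sets (PiM I (\<lambda>_. lborel)) = sets (PiM I (\<lambda>_. borel :: real measure))"
  by (intro sets_PiM_cong) auto

lemma sets_PiM_normal_noise: "sets (PiM I (normal_noise s2)) = sets (PiM I (\<lambda>_. borel))"
  by (intro sets_PiM_cong) auto

lemma nn_integral_normal_noise_shift: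
  assumes [measurable]: "g \<in> borel_measurable borel"
  shows "(\<integral>\<^sup>+t. g (c + t) \<partial>normal_noise s2 l) = (\<integral>\<^sup>+t. g t * ennreal (normal_density 0 (sqrt (s2 l)) (t - c)) \<partial>lborel)"
proof -
  have "(\<integral>\<^sup>+t. g (c + t) \<partial>normal_noise s2 l) = (\<integral>\<^sup>+t. g (c + t) * ennreal (normal_density 0 (sqrt (s2 l)) t) \<partial>lborel)"
    by (subst nn_integral_density) (auto simp: mult.commute)
  also have "\<dots> = (\<integral>\<^sup>+t. g t * ennreal (normal_density 0 (sqrt (s2 l)) (t - c)) \<partial>lborel)"
    by (subst (2) nn_integral_real_affine[where c=1 and t=c]) auto
  finally show ?thesis .
qed

text \<open>Given the earlier nodes, the last node is its noise shifted by a constant, so the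
  triangular change of variables is a composition of translations with Jacobian one. Stated for
  integrals of test functions, it passes through Fubini one node at a time.\<close>

lemma sem_solution:
  assumes "causal_order xs f"
    and "\<And>i j. f j i \<in> borel_measurable borel"
  shows "\<exists>X. X \<in> measurable (PiM (set xs) (\<lambda>_. borel)) (PiM (set xs) (\<lambda>_. borel))
    \<and> (\<forall>e. \<forall>j\<in>set xs. X e j = mu j + (\<Sum>i\<in>set xs. f j i (X e i)) + e j)
    \<and> (\<forall>g\<in>borel_measurable (PiM (set xs) (\<lambda>_. borel)).
         (\<integral>\<^sup>+e. g (X e) \<partial>PiM (set xs) (normal_noise s2))
         = (\<integral>\<^sup>+x. g x * ennreal (joint_density (set xs) mu f s2 x) \<partial>PiM (set xs) (\<lambda>_. lborel)))"
  using assms(1)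
proof (induction xs rule: rev_induct)
  case Nil
  have *: "PiM {} M = PiM {} N" for M N :: "nat \<Rightarrow> real measure"
    by (rule PiM_cong) auto
  show ?case
    by (intro exI[of _ "\<lambda>e. e"]) (auto simp: joint_density_def intro!: arg_cong2[where f=nn_integral] *)
next
  case (snoc l xs)
  note fm[measurable] = assms(2)
  let ?I = "set xs"
  have d: "causal_order xs f" and l: "l \<notin> ?I" and ll: "f l l = (\<lambda>_. 0)"
    and z: "\<And>j. j \<in> ?I \<Longrightarrow> f j l = (\<lambda>_. 0)"
    using snoc.prems by (auto simp: causal_order_def sorted_wrt_append)
  obtain X where X: "X \<in> measurable (PiM ?I (\<lambda>_. borel)) (PiM ?I (\<lambda>_. borel))"
    and Xeq: "\<And>e j. j \<in> ?I \<Longrightarrow> X e j = mu j + (\<Sum>i\<in>?I. f j i (X e i)) + e j"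
    and Xint: "\<And>g. g \<in> borel_measurable (PiM ?I (\<lambda>_. borel)) \<Longrightarrow>
         (\<integral>\<^sup>+e. g (X e) \<partial>PiM ?I (normal_noise s2))
         = (\<integral>\<^sup>+x. g x * ennreal (joint_density ?I mu f s2 x) \<partial>PiM ?I (\<lambda>_. lborel))"
    using snoc.IH[OF d] by blast
  define h where "h x = mu l + (\<Sum>i\<in>?I. f l i (x i))" for x :: "nat \<Rightarrow> real"
  \<comment> \<open>The restriction brings \<open>e\<close> into the product space on which
    \<open>X\<close> is measurable.\<close>
  define Y where "Y e = (X (restrict e ?I))(l := h (X (restrict e ?I)) + e l)" for e
  have hm[measurable]: "h \<in> borel_measurable (PiM ?I (\<lambda>_. borel))"
    unfolding h_def[abs_def]
    by (intro borel_measurable_add borel_measurable_sum borel_measurable_const measurable_PiM_coordinate fm) auto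
  have XR: "(\<lambda>e. X (restrict e ?I)) \<in> measurable (PiM (insert l ?I) (\<lambda>_. borel)) (PiM ?I (\<lambda>_. borel))"
    by (rule measurable_compose[OF measurable_restrict_subset X]) auto
  have Ym: "Y \<in> measurable (PiM (insert l ?I) (\<lambda>_. borel)) (PiM (insert l ?I) (\<lambda>_. borel))"
    unfolding Y_def[abs_def]
    by (rule measurable_fun_upd[where J="?I"])
       (use XR in \<open>auto intro!: borel_measurable_add measurable_component_singleton measurable_compose[OF XR hm]\<close>)
  have Yeq: "Y e j = mu j + (\<Sum>i\<in>insert l ?I. f j i (Y e i)) + e j" if j: "j \<in> insert l ?I" for e j
  proof -
    \<comment> \<open>No equation contains the last node \<open>l\<close> as an argument, so its
      value drops out.\<close>
    have s: "(\<Sum>i\<in>insert l ?I. f j i (Y e i)) = (\<Sum>i\<in>?I. f j i (X (restrict e ?I) i))"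
    proof -
      have "(\<Sum>i\<in>insert l ?I. f j i (Y e i)) = f j l (Y e l) + (\<Sum>i\<in>?I. f j i (Y e i))"
        using l by simp
      also have "f j l (Y e l) = 0" using j ll z by auto
      also have "(\<Sum>i\<in>?I. f j i (Y e i)) = (\<Sum>i\<in>?I. f j i (X (restrict e ?I) i))"
        using l by (intro sum.cong) (auto simp: Y_def)
      finally show ?thesis by simp
    qed
    show ?thesis
    proof (cases "j = l")
      case True then show ?thesis unfolding s by (simp add: Y_def h_def)
    next
      case False
      then have "j \<in> ?I" using j by auto
      then show ?thesis unfolding s using False Xeq[of j "restrict e ?I"] by (simp add: Y_def)
    qed
  qed
  have Yint: "(\<integral>\<^sup>+e. g (Y e) \<partial>PiM (insert l ?I) (normal_noise s2))
         = (\<integral>\<^sup>+x. g x * ennreal (joint_density (insert l ?I) mu f s2 x) \<partial>PiM (insert l ?I) (\<lambda>_. lborel))"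
    if g: "g \<in> borel_measurable (PiM (insert l ?I) (\<lambda>_. borel))" for g
  proof -
    interpret N: product_sigma_finite "normal_noise s2" by (rule product_sigma_finite_normal_noise)
    interpret L: product_sigma_finite "\<lambda>_::nat. lborel :: real measure" by (rule product_sigma_finite_lborel)
    \<comment> \<open>\<open>G x\<close> integrates out the new coordinate given the earlier ones;
      it is the test function to which the induction hypothesis \<open>Xint\<close> is
      applied.\<close>
    define G where "G x = (\<integral>\<^sup>+t. g (x(l := t)) * ennreal (normal_density 0 (sqrt (s2 l)) (t - h x)) \<partial>lborel)" for x
    have upd: "(\<lambda>(x, t). x(l := t)) \<in> measurable (PiM ?I (\<lambda>_. borel) \<Otimes>\<^sub>M borel) (PiM (insert l ?I) (\<lambda>_. borel))"
      using measurable_add_dim[of l ?I "\<lambda>_. borel :: real measure"] by simp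
    have gupd: "(\<lambda>(x, t). g (x(l := t))) \<in> borel_measurable (PiM ?I (\<lambda>_. borel) \<Otimes>\<^sub>M borel)"
      using measurable_compose[OF upd g] by (simp add: case_prod_beta')
    have gx: "(\<lambda>t. g (x(l := t))) \<in> borel_measurable borel" if "x \<in> space (PiM ?I (\<lambda>_. borel))" for x
      using measurable_Pair2[OF gupd that] by simp
    have Gm: "G \<in> borel_measurable (PiM ?I (\<lambda>_. borel))"
      unfolding G_def[abs_def]
    proof (rule lborel.borel_measurable_nn_integral)
      have "(\<lambda>(x, t). g (x(l := t)) * ennreal (normal_density 0 (sqrt (s2 l)) (t - h x))) \<in> borel_measurable (PiM ?I (\<lambda>_. borel) \<Otimes>\<^sub>M borel)"
        using gupd unfolding case_prod_beta' by measurable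
      then show "(\<lambda>(x, t). g (x(l := t)) * ennreal (normal_density 0 (sqrt (s2 l)) (t - h x))) \<in> borel_measurable (PiM ?I (\<lambda>_. borel) \<Otimes>\<^sub>M lborel)"
        by (simp cong: measurable_cong_sets)
    qed
    have gY: "(\<lambda>e. g (Y e)) \<in> borel_measurable (PiM (insert l ?I) (normal_noise s2))"
      using measurable_compose[OF Ym g] by (simp cong: measurable_cong_sets add: sets_PiM_normal_noise)
    have Yupd: "Y (x(l := t)) = (X x)(l := h (X x) + t)" if "x \<in> space (PiM ?I (\<lambda>_. borel))" for x t
    proof -
      have "restrict (x(l := t)) ?I = x"
        using that l by (fastforce simp: space_PiM PiE_def extensional_def restrict_def)
      then show ?thesis by (simp add: Y_def)
    qed
    have Xsp: "X x \<in> space (PiM ?I (\<lambda>_. borel))" if "x \<in> space (PiM ?I (\<lambda>_. borel))" for x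
      using measurable_space[OF X that] .
    have "(\<integral>\<^sup>+e. g (Y e) \<partial>PiM (insert l ?I) (normal_noise s2))
       = (\<integral>\<^sup>+x. (\<integral>\<^sup>+t. g (Y (x(l := t))) \<partial>normal_noise s2 l) \<partial>PiM ?I (normal_noise s2))"
      by (rule N.product_nn_integral_insert[OF _ l gY]) auto
    also have "\<dots> = (\<integral>\<^sup>+x. G (X x) \<partial>PiM ?I (normal_noise s2))"
    proof (rule nn_integral_cong)
      fix x assume "x \<in> space (PiM ?I (normal_noise s2))"
      then have x: "x \<in> space (PiM ?I (\<lambda>_. borel))" by (simp add: space_PiM)
      show "(\<integral>\<^sup>+t. g (Y (x(l := t))) \<partial>normal_noise s2 l) = G (X x)"
        unfolding Yupd[OF x] G_def
        using nn_integral_normal_noise_shift[OF gx[OF Xsp[OF x]]] by simp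
    qed
    also have "\<dots> = (\<integral>\<^sup>+x. G x * ennreal (joint_density ?I mu f s2 x) \<partial>PiM ?I (\<lambda>_. lborel))"
      by (rule Xint[OF Gm])
    also have "\<dots> = (\<integral>\<^sup>+x. (\<integral>\<^sup>+t. g (x(l := t)) * ennreal (joint_density (insert l ?I) mu f s2 (x(l := t))) \<partial>lborel) \<partial>PiM ?I (\<lambda>_. lborel))"
    proof (rule nn_integral_cong)
      fix x assume "x \<in> space (PiM ?I (\<lambda>_. lborel :: real measure))"
      then have x: "x \<in> space (PiM ?I (\<lambda>_. borel))" by (simp add: space_PiM)
      \<comment> \<open>Earlier residuals ignore the new coordinate, so the joint density gains
        exactly one Gaussian factor.\<close>
      have r: "resid (insert l ?I) mu f j (x(l := t)) = (if j = l then t - h x else resid ?I mu f j x)"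
        if "j \<in> insert l ?I" for j t
      proof -
        have "(\<Sum>i\<in>?I. f j i ((x(l := t)) i)) = (\<Sum>i\<in>?I. f j i (x i))"
          using l by (intro sum.cong) auto
        then show ?thesis using that l ll z by (auto simp: resid_def h_def)
      qed
      have jd: "joint_density (insert l ?I) mu f s2 (x(l := t)) = normal_density 0 (sqrt (s2 l)) (t - h x) * joint_density ?I mu f s2 x" for t
      proof -
        have "(\<Prod>j\<in>?I. normal_density 0 (sqrt (s2 j)) (resid (insert l ?I) mu f j (x(l := t)))) = joint_density ?I mu f s2 x"
          unfolding joint_density_def using l by (intro prod.cong) (auto simp: r)
        then show ?thesis using l r[of l t] by (simp add: joint_density_def)
      qed
      show "G x * ennreal (joint_density ?I mu f s2 x) = (\<integral>\<^sup>+t. g (x(l := t)) * ennreal (joint_density (insert l ?I) mu f s2 (x(l := t))) \<partial>lborel)"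
        unfolding G_def jd using gx[OF x]
        by (subst nn_integral_multc[symmetric]) (auto simp: ennreal_mult joint_density_nonneg mult.assoc)
    qed
    also have "\<dots> = (\<integral>\<^sup>+x. g x * ennreal (joint_density (insert l ?I) mu f s2 x) \<partial>PiM (insert l ?I) (\<lambda>_. lborel))"
    proof (rule L.product_nn_integral_insert[OF _ l, symmetric])
      have "joint_density (insert l ?I) mu f s2 \<in> borel_measurable (PiM (insert l ?I) (\<lambda>_. borel))"
        by (rule joint_density_measurable) auto
      then have "(\<lambda>x. g x * ennreal (joint_density (insert l ?I) mu f s2 x)) \<in> borel_measurable (PiM (insert l ?I) (\<lambda>_. borel))"
        using g by measurable
      then show "(\<lambda>x. g x * ennreal (joint_density (insert l ?I) mu f s2 x)) \<in> borel_measurable (PiM (insert l ?I) (\<lambda>_. lborel))"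
        by (simp cong: measurable_cong_sets add: sets_PiM_lborel)
    qed auto
    finally show ?thesis .
  qed
  have "set (xs @ [l]) = insert l ?I" by auto
  then show ?case using Ym Yeq Yint by (intro exI[of _ Y]) auto
qed

section \<open>PLSEM laws described without a graph\<close>

definition edge_fun :: "(nat \<Rightarrow> nat \<Rightarrow> bool) \<Rightarrow> (nat \<Rightarrow> nat \<Rightarrow> real \<Rightarrow> real) \<Rightarrow> nat \<Rightarrow> nat \<Rightarrow> real \<Rightarrow> real" where
  "edge_fun D f j i = (if D i j then f j i else (\<lambda>_. 0))"

text \<open>Graph-free form of \<open>generates\<close>, with functions on all ordered pairs and
  moments taken under \<open>P\<close>. Edges can then be reversed by changing functions only; a
  \<open>causal_order\<close> restores acyclicity.\<close>

definition plsem_law :: "nat \<Rightarrow> (nat \<Rightarrow> real) measure \<Rightarrow> (nat \<Rightarrow> real) \<Rightarrow> (nat \<Rightarrow> nat \<Rightarrow> real \<Rightarrow> real) \<Rightarrow> (nat \<Rightarrow> real) \<Rightarrow> bool" where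
  "plsem_law p P mu f s2 \<longleftrightarrow>
     (\<forall>j\<in>{1..p}. 0 < s2 j) \<and>
     (\<forall>i j. C2 (f j i) \<and> integrable P (\<lambda>x. f j i (x i)) \<and> (\<integral>x. f j i (x i) \<partial>P) = 0) \<and>
     P = density (PiM {1..p} (\<lambda>_. lborel)) (\<lambda>x. ennreal (joint_density {1..p} mu f s2 x))"

lemma C2_zero: "C2 (\<lambda>_. 0)"
  by (auto simp: C2_def)

lemma C2_continuous: "C2 g \<Longrightarrow> continuous_on UNIV g"
  by (auto simp: C2_def intro!: continuous_at_imp_continuous_on differentiable_imp_continuous_within)

lemma C2_measurable: "C2 g \<Longrightarrow> g \<in> borel_measurable borel"
  by (intro borel_measurable_continuous_onI C2_continuous)

lemma wf_dag:
  assumes "is_dag p D"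
  shows "wf {(a, b). D a b}" "wf ({(a, b). D a b}\<inverse>)"
proof -
  have "{(a, b). D a b} \<subseteq> {1..p} \<times> {1..p}" using assms by (auto simp: is_dag_def)
  then have fin: "finite {(a, b). D a b}" by (rule finite_subset) auto
  have ac: "acyclic {(a, b). D a b}"
    using assms by (auto simp: is_dag_def acyclic_def tranclp_unfold)
  show "wf {(a, b). D a b}" "wf ({(a, b). D a b}\<inverse>)"
    using fin ac by (auto intro: finite_acyclic_wf finite_acyclic_wf_converse)
qed

text \<open>A source of the remaining nodes is put first each time. Allowing any finite
  \<open>A\<close> lets blocks of nodes be sorted separately and then concatenated.\<close>

lemma topological_sort:
  assumes "is_dag p D" "finite A"
  shows "\<exists>xs. distinct xs \<and> set xs = A \<and> sorted_wrt (\<lambda>a b. \<not> D b a) xs"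
  using assms(2)
proof (induction "card A" arbitrary: A)
  case 0 then show ?case by (intro exI[of _ "[]"]) auto
next
  case (Suc n)
  then obtain a0 where "a0 \<in> A" by fastforce
  then obtain a where a: "a \<in> A" "\<And>b. D b a \<Longrightarrow> b \<notin> A"
    using wfE_min[OF wf_dag(1)[OF assms(1)]] by (metis (lifting) mem_Collect_eq case_prod_conv)
  have "n = card (A - {a})" "finite (A - {a})" using Suc.hyps(2) Suc.prems a by auto
  then obtain xs where "distinct xs" "set xs = A - {a}" "sorted_wrt (\<lambda>a b. \<not> D b a) xs"
    using Suc.hyps(1) by blast
  then show ?case using a by (intro exI[of _ "a # xs"]) auto
qed

lemma causal_order_edge_fun:
  assumes "is_dag p D" "distinct xs" "sorted_wrt (\<lambda>a b. \<not> D b a) xs"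
  shows "causal_order xs (edge_fun D f)"
proof -
  have "\<not> D a a" for a using assms(1) by (auto simp: is_dag_def)
  then show ?thesis using assms(2,3)
    by (auto simp: causal_order_def edge_fun_def elim!: sorted_wrt_mono_rel[rotated])
qed

lemma sum_parents_eq:
  assumes "is_dag p D"
  shows "(\<Sum>i\<in>{i. D i j}. f j i (x i)) = (\<Sum>i\<in>{1..p}. edge_fun D f j i (x i))"
  using assms by (intro sum.mono_neutral_cong_left) (auto simp: is_dag_def edge_fun_def)

text \<open>Well-founded induction along \<open>D\<close>: once the parents agree, equal residuals
  force equal coordinates. With \<open>A\<close> all nodes this is uniqueness of the solution; with
  a smaller ancestral \<open>A\<close> it needs only the residuals in \<open>A\<close>.\<close>

lemma resid_determines:
  assumes dag: "is_dag p D" and A: "A \<subseteq> {1..p}" and closed: "\<And>a j. j \<in> A \<Longrightarrow> D a j \<Longrightarrow> a \<in> A"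
    and eq: "\<And>j. j \<in> A \<Longrightarrow> resid {1..p} mu (edge_fun D f) j x = resid {1..p} mu (edge_fun D f) j y"
  shows "j \<in> A \<Longrightarrow> x j = y j"
proof (induction j rule: wf_induct_rule[OF wf_dag(1)[OF dag]])
  case (1 j)
  have "(\<Sum>i\<in>{1..p}. edge_fun D f j i (x i)) = (\<Sum>i\<in>{1..p}. edge_fun D f j i (y i))"
    using 1 closed by (intro sum.cong) (auto simp: edge_fun_def)
  then show ?case using eq[OF 1(2)] by (simp add: resid_def)
qed

text \<open>The integral formula is applied to indicators.\<close>

lemma distr_solution_eq_density:
  assumes X: "X \<in> measurable (PiM I (\<lambda>_. borel)) (PiM I (\<lambda>_. borel))"
    and f: "\<And>i j. f j i \<in> borel_measurable borel"
    and Xint: "\<And>g. g \<in> borel_measurable (PiM I (\<lambda>_. borel)) \<Longrightarrow>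
         (\<integral>\<^sup>+e. g (X e) \<partial>PiM I (normal_noise s2))
         = (\<integral>\<^sup>+x. g x * ennreal (joint_density I mu f s2 x) \<partial>PiM I (\<lambda>_. lborel))"
  shows "distr (PiM I (normal_noise s2)) (PiM I (\<lambda>_. borel)) X
    = density (PiM I (\<lambda>_. lborel)) (\<lambda>x. ennreal (joint_density I mu f s2 x))"
proof (rule measure_eqI)
  show "sets (distr (PiM I (normal_noise s2)) (PiM I (\<lambda>_. borel)) X)
    = sets (density (PiM I (\<lambda>_. lborel)) (\<lambda>x. ennreal (joint_density I mu f s2 x)))"
    by (simp add: sets_PiM_lborel)
  fix A assume "A \<in> sets (distr (PiM I (normal_noise s2)) (PiM I (\<lambda>_. borel)) X)"
  then have A: "A \<in> sets (PiM I (\<lambda>_. borel))" by simp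
  have Xm: "X \<in> measurable (PiM I (normal_noise s2)) (PiM I (\<lambda>_. borel))"
    using X by (simp cong: measurable_cong_sets add: sets_PiM_normal_noise)
  have "emeasure (distr (PiM I (normal_noise s2)) (PiM I (\<lambda>_. borel)) X) A
    = (\<integral>\<^sup>+x. indicator A x \<partial>distr (PiM I (normal_noise s2)) (PiM I (\<lambda>_. borel)) X)"
    using A by simp
  also have "\<dots> = (\<integral>\<^sup>+e. indicator A (X e) \<partial>PiM I (normal_noise s2))"
    using A by (intro nn_integral_distr[OF Xm]) auto
  also have "\<dots> = (\<integral>\<^sup>+x. indicator A x * ennreal (joint_density I mu f s2 x) \<partial>PiM I (\<lambda>_. lborel))"
    using A by (intro Xint) auto
  also have "\<dots> = (\<integral>\<^sup>+x. ennreal (joint_density I mu f s2 x) * indicator A x \<partial>PiM I (\<lambda>_. lborel))"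
    by (simp add: mult.commute)
  also have "\<dots> = emeasure (density (PiM I (\<lambda>_. lborel)) (\<lambda>x. ennreal (joint_density I mu f s2 x))) A"
    using joint_density_measurable[of I f mu s2] f A
    by (intro emeasure_density[symmetric]) (simp_all cong: measurable_cong_sets add: sets_PiM_lborel)
  finally show "emeasure (distr (PiM I (normal_noise s2)) (PiM I (\<lambda>_. borel)) X) A
    = emeasure (density (PiM I (\<lambda>_. lborel)) (\<lambda>x. ennreal (joint_density I mu f s2 x))) A" .
qed

lemma C2_edge_fun: "generates p P D mu f s2 \<Longrightarrow> C2 (edge_fun D f j i)"
  by (auto simp: generates_def edge_fun_def C2_zero)

text \<open>Replaces the solution hidden in \<open>generates\<close> by one that is defined for
  every noise vector and inverts the residual map, and supplies the density of
  \<open>P\<close>.\<close>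

lemma generates_solution:
  assumes gen: "generates p P D mu f s2"
  obtains X where "X \<in> measurable (PiM {1..p} (\<lambda>_. borel)) (PiM {1..p} (\<lambda>_. borel))"
    "\<And>e j. j \<in> {1..p} \<Longrightarrow> resid {1..p} mu (edge_fun D f) j (X e) = e j"
    "P = distr (noise_space p s2) (PiM {1..p} (\<lambda>_. borel)) X"
    "P = density (PiM {1..p} (\<lambda>_. lborel)) (\<lambda>x. ennreal (joint_density {1..p} mu (edge_fun D f) s2 x))"
proof -
  let ?I = "{1..p}"
  have dag: "is_dag p D" using gen by (simp add: generates_def)
  obtain xs where xs: "distinct xs" "set xs = ?I" "sorted_wrt (\<lambda>a b. \<not> D b a) xs"
    using topological_sort[OF dag] by blast
  have co: "causal_order xs (edge_fun D f)" using causal_order_edge_fun[OF dag] xs by blast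
  have fm: "edge_fun D f j i \<in> borel_measurable borel" for j i
    by (rule C2_measurable[OF C2_edge_fun[OF gen]])
  obtain X where X: "X \<in> measurable (PiM ?I (\<lambda>_. borel)) (PiM ?I (\<lambda>_. borel))"
    and Xeq: "\<And>e j. j \<in> ?I \<Longrightarrow> X e j = mu j + (\<Sum>i\<in>?I. edge_fun D f j i (X e i)) + e j"
    and Xint: "\<And>g. g \<in> borel_measurable (PiM ?I (\<lambda>_. borel)) \<Longrightarrow>
         (\<integral>\<^sup>+e. g (X e) \<partial>PiM ?I (normal_noise s2))
         = (\<integral>\<^sup>+x. g x * ennreal (joint_density ?I mu (edge_fun D f) s2 x) \<partial>PiM ?I (\<lambda>_. lborel))"
    using sem_solution[OF co fm, where mu=mu and ?s2.0=s2] unfolding xs(2) by blast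
  obtain Y :: "(nat \<Rightarrow> real) \<Rightarrow> nat \<Rightarrow> real" where
    Yeq: "\<And>e j. e \<in> space (noise_space p s2) \<Longrightarrow> j \<in> ?I \<Longrightarrow> Y e j = mu j + (\<Sum>i \<in> {i. D i j}. f j i (Y e i)) + e j"
    and PY: "P = distr (noise_space p s2) (PiM ?I (\<lambda>_. borel)) (\<lambda>e. restrict (Y e) ?I)"
    using gen unfolding generates_def by blast
  have r: "resid ?I mu (edge_fun D f) j (X e) = e j" if "j \<in> ?I" for e j
    using Xeq[OF that, of e] by (simp add: resid_def)
  \<comment> \<open>Uniqueness of the solution identifies the given \<open>Y\<close> with
    \<open>X\<close>; outside \<open>{1..p}\<close> both sides are \<open>undefined\<close>.\<close>
  have "restrict (Y e) ?I = X e" if e: "e \<in> space (noise_space p s2)" for e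
  proof
    fix j
    have "X e \<in> space (PiM ?I (\<lambda>_. borel))"
      using e measurable_space[OF X] by (simp add: noise_space_def space_PiM)
    then have ext: "j \<notin> ?I \<Longrightarrow> X e j = undefined" by (simp add: space_PiM PiE_def extensional_def)
    have "resid ?I mu (edge_fun D f) j (Y e) = e j" if "j \<in> ?I" for j
      using Yeq[OF e that] sum_parents_eq[OF dag, of f j "Y e"] by (simp add: resid_def)
    then have eq: "resid ?I mu (edge_fun D f) j (Y e) = resid ?I mu (edge_fun D f) j (X e)" if "j \<in> ?I" for j
      using r that by simp
    have "a \<in> ?I" if "D a j" for a j using dag that unfolding is_dag_def by blast
    then have "j \<in> ?I \<Longrightarrow> Y e j = X e j"
      using resid_determines[OF dag order_refl _ eq] by blast
    then show "restrict (Y e) ?I j = X e j" using ext by (auto simp: restrict_def)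
  qed
  then have PX: "P = distr (noise_space p s2) (PiM ?I (\<lambda>_. borel)) X"
    unfolding PY by (intro distr_cong) auto
  moreover have "distr (noise_space p s2) (PiM ?I (\<lambda>_. borel)) X
    = density (PiM ?I (\<lambda>_. lborel)) (\<lambda>x. ennreal (joint_density ?I mu (edge_fun D f) s2 x))"
    unfolding noise_space_def using distr_solution_eq_density[OF X fm Xint] .
  ultimately show thesis using that[OF X r] by simp
qed

lemma generates_imp_plsem_law:
  assumes gen: "generates p P D mu f s2"
  shows "plsem_law p P mu (edge_fun D f) s2"
proof -
  let ?I = "{1..p}"
  obtain Y :: "(nat \<Rightarrow> real) \<Rightarrow> nat \<Rightarrow> real" where
    Ym: "(\<lambda>e. restrict (Y e) ?I) \<in> measurable (noise_space p s2) (PiM ?I (\<lambda>_. borel))"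
    and YE: "\<And>i j. D i j \<Longrightarrow> integrable (noise_space p s2) (\<lambda>e. f j i (Y e i))"
      "\<And>i j. D i j \<Longrightarrow> (\<integral>e. f j i (Y e i) \<partial>noise_space p s2) = 0"
    and PY: "P = distr (noise_space p s2) (PiM ?I (\<lambda>_. borel)) (\<lambda>e. restrict (Y e) ?I)"
    using gen unfolding generates_def by blast
  have "integrable P (\<lambda>x. f j i (x i)) \<and> (\<integral>x. f j i (x i) \<partial>P) = 0" if D: "D i j" for i j
  proof -
    have i: "i \<in> ?I" using gen D by (auto simp: generates_def is_dag_def)
    have "f j i \<in> borel_measurable borel"
      using gen D by (intro C2_measurable) (auto simp: generates_def)
    then have m: "(\<lambda>x. f j i (x i)) \<in> borel_measurable (PiM ?I (\<lambda>_. borel))"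
      using i by (intro measurable_PiM_coordinate)
    show ?thesis unfolding PY integrable_distr_eq[OF Ym m] integral_distr[OF Ym m]
      using YE[OF D] i by simp
  qed
  then have "integrable P (\<lambda>x. edge_fun D f j i (x i)) \<and> (\<integral>x. edge_fun D f j i (x i) \<partial>P) = 0" for i j
    by (auto simp: edge_fun_def)
  moreover have "\<forall>j\<in>?I. 0 < s2 j" using gen by (auto simp: generates_def)
  moreover have "P = density (PiM ?I (\<lambda>_. lborel)) (\<lambda>x. ennreal (joint_density ?I mu (edge_fun D f) s2 x))"
    using generates_solution[OF gen] by blast
  ultimately show ?thesis using C2_edge_fun[OF gen] unfolding plsem_law_def by blast
qed

text \<open>An edge that stayed in place or went backward in \<open>xs\<close> would carry the zero
  function, so positions strictly increase along directed paths.\<close>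

lemma causal_order_tranclp:
  assumes co: "causal_order xs f" and D: "\<And>a b. D a b \<Longrightarrow> a \<in> set xs \<and> b \<in> set xs \<and> f b a \<noteq> (\<lambda>_. 0)"
    and "D\<^sup>+\<^sup>+ u v"
  shows "\<exists>m n. m < n \<and> n < length xs \<and> xs ! m = u \<and> xs ! n = v"
  using assms(3)
proof (induction rule: tranclp_induct)
  case (base v)
  obtain m n where mn: "m < length xs" "xs ! m = u" "n < length xs" "xs ! n = v"
    using D[OF base] by (auto simp: in_set_conv_nth)
  have "m \<noteq> n" using D[OF base] co mn by (auto simp: causal_order_def)
  moreover have "\<not> n < m"
    using D[OF base] co mn sorted_wrt_nth_less[of "\<lambda>a b. f a b = (\<lambda>_. 0)" xs n m] by (auto simp: causal_order_def)
  ultimately show ?case using mn by (metis linorder_neqE_nat)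
next
  case (step v w)
  obtain m n where mn: "m < length xs" "xs ! m = v" "n < length xs" "xs ! n = w"
    using D[OF step.hyps(2)] by (auto simp: in_set_conv_nth)
  have "m \<noteq> n" using D[OF step.hyps(2)] co mn by (auto simp: causal_order_def)
  moreover have "\<not> n < m"
    using D[OF step.hyps(2)] co mn sorted_wrt_nth_less[of "\<lambda>a b. f a b = (\<lambda>_. 0)" xs n m] by (auto simp: causal_order_def)
  ultimately have "m < n" by simp
  obtain m' n' where "m' < n'" "n' < length xs" "xs ! m' = u" "xs ! n' = v" using step.IH by blast
  moreover have "n' = m" using calculation mn co by (auto simp: causal_order_def nth_eq_iff_index_eq)
  ultimately show ?case using \<open>m < n\<close> mn by (metis less_trans)
qed

definition support_graph :: "nat \<Rightarrow> (nat \<Rightarrow> nat \<Rightarrow> real \<Rightarrow> real) \<Rightarrow> nat \<Rightarrow> nat \<Rightarrow> bool" where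
  "support_graph p f i j \<longleftrightarrow> i \<in> {1..p} \<and> j \<in> {1..p} \<and> f j i \<noteq> (\<lambda>_. 0)"

text \<open>The graph consists of the pairs with a nonzero function, since \<open>generates\<close>
  demands nonzero functions on edges.\<close>

lemma plsem_law_imp_generates:
  assumes law: "plsem_law p P mu f s2" and co: "causal_order xs f" and xs: "set xs = {1..p}"
  shows "generates p P (support_graph p f) mu f s2"
proof -
  let ?I = "{1..p}" and ?D = "support_graph p f"
  have pos: "\<forall>j\<in>?I. 0 < s2 j" and C: "\<And>i j. C2 (f j i)"
    and mom: "\<And>i j. integrable P (\<lambda>x. f j i (x i))" "\<And>i j. (\<integral>x. f j i (x i) \<partial>P) = 0"
    and P: "P = density (PiM ?I (\<lambda>_. lborel)) (\<lambda>x. ennreal (joint_density ?I mu f s2 x))"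
    using law unfolding plsem_law_def by blast+
  have dag: "is_dag p ?D"
    unfolding is_dag_def
  proof (intro conjI allI impI notI)
    \<comment> \<open>A directed cycle would place one node at two different positions of
      \<open>xs\<close>.\<close>
    fix u assume "?D\<^sup>+\<^sup>+ u u"
    then obtain m n where "m < n" "n < length xs" "xs ! m = u" "xs ! n = u"
      using causal_order_tranclp[OF co, of ?D u u] xs by (force simp: support_graph_def)
    then show False using co by (auto simp: causal_order_def nth_eq_iff_index_eq)
  qed (auto simp: support_graph_def)
  have fm: "f j i \<in> borel_measurable borel" for j i by (rule C2_measurable[OF C])
  obtain X where X: "X \<in> measurable (PiM ?I (\<lambda>_. borel)) (PiM ?I (\<lambda>_. borel))"
    and Xeq: "\<And>e j. j \<in> ?I \<Longrightarrow> X e j = mu j + (\<Sum>i\<in>?I. f j i (X e i)) + e j"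
    and Xint: "\<And>g. g \<in> borel_measurable (PiM ?I (\<lambda>_. borel)) \<Longrightarrow>
         (\<integral>\<^sup>+e. g (X e) \<partial>PiM ?I (normal_noise s2))
         = (\<integral>\<^sup>+x. g x * ennreal (joint_density ?I mu f s2 x) \<partial>PiM ?I (\<lambda>_. lborel))"
    using sem_solution[OF co fm, where mu=mu and ?s2.0=s2] unfolding xs by blast
  have PX: "P = distr (noise_space p s2) (PiM ?I (\<lambda>_. borel)) X"
    unfolding P noise_space_def using distr_solution_eq_density[OF X fm Xint] by simp
  have Xm: "X \<in> measurable (noise_space p s2) (PiM ?I (\<lambda>_. borel))"
    using X unfolding noise_space_def by (simp cong: measurable_cong_sets add: sets_PiM_normal_noise)
  have Xr: "restrict (X e) ?I = X e" if "e \<in> space (noise_space p s2)" for e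
    using measurable_space[OF Xm that] by (simp add: space_PiM PiE_restrict)
  have rX: "(\<lambda>e. restrict (X e) ?I) \<in> measurable (noise_space p s2) (PiM ?I (\<lambda>_. borel))"
    using Xm by (subst measurable_cong[OF Xr])
  have Yeq: "X e j = mu j + (\<Sum>i\<in>{i. ?D i j}. f j i (X e i)) + e j" if "j \<in> ?I" for e j
  proof -
    have "(\<Sum>i\<in>{i. ?D i j}. f j i (X e i)) = (\<Sum>i\<in>?I. f j i (X e i))"
      using that by (intro sum.mono_neutral_left) (auto simp: support_graph_def)
    then show ?thesis using Xeq[OF that] by simp
  qed
  have E: "integrable (noise_space p s2) (\<lambda>e. f j i (X e i)) \<and> (\<integral>e. f j i (X e i) \<partial>noise_space p s2) = 0"
    if "?D i j" for i j
  proof -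
    have m: "(\<lambda>x. f j i (x i)) \<in> borel_measurable (PiM ?I (\<lambda>_. borel))"
      using fm that by (intro measurable_PiM_coordinate) (auto simp: support_graph_def)
    show ?thesis using mom[where i=i and j=j]
      unfolding PX integrable_distr_eq[OF Xm m] integral_distr[OF Xm m] by simp
  qed
  have "P = distr (noise_space p s2) (PiM ?I (\<lambda>_. borel)) (\<lambda>e. restrict (X e) ?I)"
    unfolding PX by (rule distr_cong[OF refl refl Xr[symmetric]])
  moreover have "\<forall>i j. ?D i j \<longrightarrow> C2 (f j i) \<and> f j i \<noteq> (\<lambda>_. 0)"
    using C by (auto simp: support_graph_def)
  ultimately show ?thesis
    using dag pos rX Yeq E unfolding generates_def by blast
qed

section \<open>Linear dependence of the residuals of equivalent PLSEMs\<close>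

text \<open>Equal laws give densities that agree almost everywhere. The set where two continuous
  functions differ is open, so if nonempty it contains a box, and a box around a point has positive
  Lebesgue measure.\<close>

lemma density_eq_imp_eq:
  fixes d d' :: "(nat \<Rightarrow> real) \<Rightarrow> real"
  assumes I: "finite I" and cont: "continuous_on UNIV d" "continuous_on UNIV d'"
    and nonneg: "\<And>x. 0 \<le> d x" "\<And>x. 0 \<le> d' x"
    and meas: "d \<in> borel_measurable (PiM I (\<lambda>_. borel))" "d' \<in> borel_measurable (PiM I (\<lambda>_. borel))"
    and eq: "density (PiM I (\<lambda>_. lborel)) (\<lambda>x. ennreal (d x)) = density (PiM I (\<lambda>_. lborel)) (\<lambda>x. ennreal (d' x))"
    and x: "x \<in> extensional I"
  shows "d x = d' x"
proof (rule ccontr)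
  assume "d x \<noteq> d' x"
  interpret L: product_sigma_finite "\<lambda>_::nat. lborel :: real measure" by (rule product_sigma_finite_lborel)
  interpret S: sigma_finite_measure "PiM I (\<lambda>_. lborel :: real measure)" by (rule L.sigma_finite[OF I])
  have m: "(\<lambda>x. ennreal (d x)) \<in> borel_measurable (PiM I (\<lambda>_. lborel))" "(\<lambda>x. ennreal (d' x)) \<in> borel_measurable (PiM I (\<lambda>_. lborel))"
    using meas by (simp_all cong: measurable_cong_sets add: sets_PiM_lborel)
  have "AE y in PiM I (\<lambda>_. lborel). ennreal (d y) = ennreal (d' y)"
    by (rule S.density_unique[OF m eq])
  then have AE: "AE y in PiM I (\<lambda>_. lborel). d y = d' y" using nonneg by simp
  have "open {y. d y \<noteq> d' y}"
    using open_Collect_neq[OF cont] .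
  then have "openin (product_topology (\<lambda>_. euclidean) UNIV) {y. d y \<noteq> d' y}"
    unfolding open_fun_def .
  from product_topology_open_contains_basis[OF this, of x] \<open>d x \<noteq> d' x\<close>
  have "\<exists>U. x \<in> (\<Pi>\<^sub>E i\<in>UNIV. U i) \<and> (\<forall>i. open (U i)) \<and> (\<Pi>\<^sub>E i\<in>UNIV. U i) \<subseteq> {y. d y \<noteq> d' y}"
    by auto
  then obtain U where U: "x \<in> (\<Pi>\<^sub>E i\<in>UNIV. U i)" "\<And>i. open (U i)" "(\<Pi>\<^sub>E i\<in>UNIV. U i) \<subseteq> {y. d y \<noteq> d' y}"
    by blast
  \<comment> \<open>Outside \<open>I\<close> both points are \<open>undefined\<close>, so the
    finite-dimensional box lies in the full basic open set.\<close>
  have sub: "y \<in> (\<Pi>\<^sub>E i\<in>UNIV. U i)" if "y \<in> PiE I U" for y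
  proof -
    have "y i \<in> U i" for i
    proof (cases "i \<in> I")
      case False
      then have "y i = x i" using that x by (simp add: PiE_def extensional_def)
      then show ?thesis using U(1) by auto
    qed (use that in auto)
    then show ?thesis by auto
  qed
  have sets: "PiE I U \<in> sets (PiM I (\<lambda>_. lborel))"
    using U(2) by (intro sets_PiM_I_finite[OF I]) auto
  have "AE y in PiM I (\<lambda>_. lborel). y \<notin> PiE I U"
    using AE by eventually_elim (use sub U(3) in blast)
  then have "PiE I U \<in> null_sets (PiM I (\<lambda>_. lborel))"
    using AE_iff_null_sets[OF sets] by simp
  \<comment> \<open>A null box has a null side, yet each side contains an interval around
    \<open>x i\<close>.\<close>
  then have "(\<Prod>i\<in>I. emeasure lborel (U i)) = 0"
    using L.emeasure_PiM[OF I, of U] U(2) by auto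
  then obtain i where i: "i \<in> I" "emeasure lborel (U i) = 0" using I by (auto simp: prod_zero_iff)
  have "x i \<in> U i" using U(1) by auto
  then obtain e where e: "e > 0" "ball (x i) e \<subseteq> U i" using U(2)[of i] openE by blast
  have "emeasure lborel (ball (x i) e) \<le> emeasure lborel (U i)"
    using e(2) U(2) by (intro emeasure_mono) auto
  moreover have "ball (x i) e = {x i - e<..<x i + e}" by (auto simp: dist_real_def)
  ultimately show False using i e(1) by simp
qed

section \<open>Bilinear forms and isotropic vectors\<close>

definition bform :: "nat set \<Rightarrow> (nat \<Rightarrow> nat \<Rightarrow> real) \<Rightarrow> (nat \<Rightarrow> real) \<Rightarrow> (nat \<Rightarrow> real) \<Rightarrow> real" where
  "bform I K u v = (\<Sum>a\<in>I. \<Sum>b\<in>I. K a b * u a * v b)"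

lemma bform_commute:
  assumes "\<And>a b. K a b = K b a"
  shows "bform I K u v = bform I K v u"
  unfolding bform_def by (subst sum.swap) (simp add: assms[of _ _] mult_ac)

lemma bform_add_left: "bform I K (\<lambda>a. u a + u' a) v = bform I K u v + bform I K u' v"
  by (simp add: bform_def algebra_simps sum.distrib)

lemma bform_add_right: "bform I K u (\<lambda>a. v a + v' a) = bform I K u v + bform I K u v'"
  by (simp add: bform_def algebra_simps sum.distrib)

lemma bform_scale_left: "bform I K (\<lambda>a. s * u a) v = s * bform I K u v"
  by (simp add: bform_def sum_distrib_left mult_ac)

lemma bform_scale_right: "bform I K u (\<lambda>a. s * v a) = s * bform I K u v"
  by (simp add: bform_def sum_distrib_left mult_ac)

lemma bform_eq_sum: "bform I K u v = (\<Sum>b\<in>I. (\<Sum>a\<in>I. K a b * u a) * v b)"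
  unfolding bform_def by (subst sum.swap) (simp add: sum_distrib_right)

lemma linear_bounded_below:
  fixes A B :: real
  assumes "\<And>s. 0 \<le> A * s + B"
  shows "A = 0"
proof (rule ccontr)
  assume "A \<noteq> 0"
  then show False using assms[of "-(B + 1) / A"] by simp
qed

text \<open>A quadratic form bounded below is positive semidefinite, and its isotropic vectors lie
  in its kernel: along \<open>s * v + \<delta>\<close> the form is affine in \<open>s\<close>, so
  boundedness forces the slope, twice an entry of \<open>K v\<close>, to vanish.\<close>

lemma bform_isotropic:
  assumes I: "finite I" and sym: "\<And>a b. K a b = K b a" and bdd: "\<And>u. c \<le> bform I K u u"
    and v: "bform I K v v = 0" and b: "b \<in> I"
  shows "(\<Sum>a\<in>I. K a b * v a) = 0"
proof -
  define \<delta> where "\<delta> a = (if a = b then 1 else 0 :: real)" for a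
  have vb: "bform I K v \<delta> = (\<Sum>a\<in>I. K a b * v a)"
    unfolding bform_eq_sum \<delta>_def using I b by (simp add: if_distrib cong: if_cong)
  have "0 \<le> (2 * bform I K v \<delta>) * s + (bform I K \<delta> \<delta> - c)" for s
  proof -
    have "bform I K (\<lambda>a. s * v a + \<delta> a) (\<lambda>a. s * v a + \<delta> a) = 2 * s * bform I K v \<delta> + bform I K \<delta> \<delta>"
      unfolding bform_add_left bform_add_right bform_scale_left bform_scale_right
      using v bform_commute[of K I \<delta> v, OF sym] by simp
    then show ?thesis using bdd[of "\<lambda>a. s * v a + \<delta> a"] by (simp add: algebra_simps)
  qed
  from linear_bounded_below[OF this] show ?thesis unfolding vb by simp
qed

lemma bform_has_derivative:
  assumes "\<And>a. a \<in> I \<Longrightarrow> (u a has_real_derivative u' a) (at t)"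
    "\<And>a. a \<in> I \<Longrightarrow> (v a has_real_derivative v' a) (at t)"
  shows "((\<lambda>t. bform I K (\<lambda>a. u a t) (\<lambda>a. v a t)) has_real_derivative
    bform I K u' (\<lambda>a. v a t) + bform I K (\<lambda>a. u a t) v') (at t)"
  unfolding bform_def sum.distrib[symmetric]
  by (rule derivative_eq_intros refl assms sum.cong | assumption | simp add: algebra_simps)+

text \<open>The second derivative of \<open>eq\<close> in \<open>x l\<close> makes \<open>K \<phi>'' \<bullet> r x\<close> a function of \<open>x l\<close> alone; by
  \<open>tri\<close> then \<open>\<phi>'' \<bullet> K \<phi>'' = 0\<close>. Surjectivity of \<open>r\<close> makes \<open>K\<close> positive semidefinite, so
  \<open>K \<phi>'' = 0\<close> and \<open>K \<phi>'\<close> is constant.\<close>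
lemma peel_sink:
  fixes r g :: "nat \<Rightarrow> (nat \<Rightarrow> real) \<Rightarrow> real" and \<phi> \<phi>' \<phi>'' :: "nat \<Rightarrow> real \<Rightarrow> real"
  assumes I: "finite I" and S: "finite S" "l \<notin> S"
    and sym: "\<And>a b. K a b = K b a"
    and surj: "\<And>u. \<exists>x. \<forall>a\<in>I. r a x = u a"
    and pos: "\<And>m. m \<in> insert l S \<Longrightarrow> 0 < v m"
    and eq: "\<And>x. (\<Sum>m\<in>insert l S. (g m x)\<^sup>2 / v m) = bform I K (\<lambda>a. r a x) (\<lambda>a. r a x) + c"
    and gS: "\<And>m x t. m \<in> S \<Longrightarrow> g m (x(l := t)) = g m x"
    and gl: "\<And>x t. g l (x(l := t)) = g l x + (t - x l)"
    and r: "\<And>a x t. a \<in> I \<Longrightarrow> r a (x(l := t)) = r a x + (\<phi> a t - \<phi> a (x l))"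
    and \<phi>: "\<And>a t. (\<phi> a has_real_derivative \<phi>' a t) (at t)"
    and \<phi>': "\<And>a t. (\<phi>' a has_real_derivative \<phi>'' a t) (at t)"
    and tri: "\<And>n C t0. (\<And>x. x l = t0 \<Longrightarrow> (\<Sum>b\<in>I. n b * r b x) = C) \<Longrightarrow> (\<Sum>b\<in>I. n b * \<phi>'' b t0) = 0"
  shows "\<exists>w. \<forall>x. g l x = (\<Sum>b\<in>I. w b * r b x)"
proof -
  have vl: "0 < v l" using pos by simp
  \<comment> \<open>A sum of squares is nonnegative, and by \<open>surj\<close> every vector occurs
    as a residual vector.\<close>
  have bdd: "- c \<le> bform I K u u" for u
  proof -
    obtain x where x: "\<forall>a\<in>I. r a x = u a" using surj by blast
    then have "bform I K (\<lambda>a. r a x) (\<lambda>a. r a x) = bform I K u u" by (simp add: bform_def)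
    moreover have "0 \<le> (\<Sum>m\<in>insert l S. (g m x)\<^sup>2 / v m)"
      using pos by (intro sum_nonneg divide_nonneg_pos) auto
    ultimately show ?thesis using eq[of x] by simp
  qed
  have rd: "((\<lambda>t. r a (x(l := t))) has_real_derivative \<phi>' a t) (at t)" if "a \<in> I" for a x t
    unfolding r[OF that] by (auto intro!: derivative_eq_intros \<phi>)
  \<comment> \<open>On the left of \<open>eq\<close> only the square of \<open>g l\<close> depends
    on the coordinate \<open>l\<close>; differentiating both sides and halving gives the
    claim.\<close>
  have d1: "(g l x + (t - x l)) / v l = bform I K (\<lambda>a. \<phi>' a t) (\<lambda>a. r a (x(l := t)))" for x t
  proof -
    let ?R = "\<lambda>t. bform I K (\<lambda>a. r a (x(l := t))) (\<lambda>a. r a (x(l := t)))"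
    have R: "?R = (\<lambda>t. (\<Sum>m\<in>S. (g m x)\<^sup>2 / v m) + (g l x + (t - x l))\<^sup>2 / v l - c)"
    proof
      fix t
      have "(\<Sum>m\<in>S. (g m (x(l := t)))\<^sup>2 / v m) = (\<Sum>m\<in>S. (g m x)\<^sup>2 / v m)" by (simp add: gS)
      then show "?R t = (\<Sum>m\<in>S. (g m x)\<^sup>2 / v m) + (g l x + (t - x l))\<^sup>2 / v l - c"
        using eq[of "x(l := t)"] S gl[of x t] by simp
    qed
    have "(?R has_real_derivative 2 * (g l x + (t - x l)) / v l) (at t)"
      unfolding R using vl by (auto intro!: derivative_eq_intros)
    moreover have "(?R has_real_derivative bform I K (\<lambda>a. \<phi>' a t) (\<lambda>a. r a (x(l := t))) + bform I K (\<lambda>a. r a (x(l := t))) (\<lambda>a. \<phi>' a t)) (at t)"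
      by (rule bform_has_derivative) (auto intro: rd)
    ultimately have *: "2 * (g l x + (t - x l)) / v l = bform I K (\<lambda>a. \<phi>' a t) (\<lambda>a. r a (x(l := t))) + bform I K (\<lambda>a. r a (x(l := t))) (\<lambda>a. \<phi>' a t)"
      by (rule DERIV_unique)
    have "A / v l = B" if "2 * A / v l = B + C" "C = B" for A B C
      using that vl by (simp add: field_simps)
    from this[OF * bform_commute[OF sym]] show ?thesis .
  qed
  have d2: "1 / v l = bform I K (\<lambda>a. \<phi>'' a t) (\<lambda>a. r a (x(l := t))) + bform I K (\<lambda>a. \<phi>' a t) (\<lambda>a. \<phi>' a t)" for x t
  proof -
    have "((\<lambda>t. (g l x + (t - x l)) / v l) has_real_derivative 1 / v l) (at t)"
      using vl by (auto intro!: derivative_eq_intros)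
    moreover have "((\<lambda>t. bform I K (\<lambda>a. \<phi>' a t) (\<lambda>a. r a (x(l := t)))) has_real_derivative
       bform I K (\<lambda>a. \<phi>'' a t) (\<lambda>a. r a (x(l := t))) + bform I K (\<lambda>a. \<phi>' a t) (\<lambda>a. \<phi>' a t)) (at t)"
      by (rule bform_has_derivative) (auto intro: rd \<phi>')
    ultimately show ?thesis unfolding d1 by (rule DERIV_unique)
  qed
  define n where "n t b = (\<Sum>a\<in>I. K a b * \<phi>'' a t)" for t b
  have n0: "n t b = 0" if "b \<in> I" for t b
  proof -
    have "(\<Sum>b\<in>I. n t b * \<phi>'' b t) = 0"
    proof (rule tri)
      fix x :: "nat \<Rightarrow> real" assume "x l = t"
      then have "x(l := t) = x" by auto
      then have "bform I K (\<lambda>a. \<phi>'' a t) (\<lambda>a. r a x) = 1 / v l - bform I K (\<lambda>a. \<phi>' a t) (\<lambda>a. \<phi>' a t)"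
        using d2[of t x] by simp
      then show "(\<Sum>b\<in>I. n t b * r b x) = 1 / v l - bform I K (\<lambda>a. \<phi>' a t) (\<lambda>a. \<phi>' a t)"
        by (simp add: n_def bform_eq_sum)
    qed
    then have "bform I K (\<lambda>a. \<phi>'' a t) (\<lambda>a. \<phi>'' a t) = 0" by (simp add: n_def bform_eq_sum)
    from bform_isotropic[OF I sym bdd this that] show ?thesis by (simp add: n_def)
  qed
  \<comment> \<open>These are the coefficients in \<open>d1\<close>. Their derivatives are
    \<open>n t b\<close>, which vanish, so they may be frozen at the arbitrary base point
    \<open>0\<close>.\<close>
  define w where "w b t = (\<Sum>a\<in>I. K a b * \<phi>' a t)" for b t
  have "(w b has_real_derivative n t b) (at t)" for b t
    unfolding w_def[abs_def] n_def by (auto intro!: derivative_eq_intros \<phi>' simp: mult.commute)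
  then have "\<forall>t. (w b has_real_derivative 0) (at t)" if "b \<in> I" for b
    using n0[OF that] by metis
  then have w: "w b t = w b 0" if "b \<in> I" for b t
    using DERIV_isconst_all that by blast
  have "g l x = (\<Sum>b\<in>I. (v l * w b 0) * r b x)" for x
  proof -
    have "g l x / v l = bform I K (\<lambda>a. \<phi>' a (x l)) (\<lambda>a. r a x)"
      using d1[of x "x l"] by simp
    also have "\<dots> = (\<Sum>b\<in>I. w b 0 * r b x)"
      unfolding bform_eq_sum w_def[symmetric] by (intro sum.cong) (simp_all add: w[of _ "x l"])
    finally show ?thesis using vl by (simp add: field_simps sum_distrib_left)
  qed
  then show ?thesis by (intro exI[of _ "\<lambda>b. v l * w b 0"] allI)
qed

text \<open>The change is written as a difference of one function of \<open>x l\<close> at two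
  arguments, the form that \<open>peel_sink\<close> requires.\<close>

lemma resid_fun_upd:
  assumes "finite I" "l \<in> I"
  shows "resid I mu f a (x(l := t)) = resid I mu f a x
    + (((if a = l then t else 0) - f a l t) - ((if a = l then x l else 0) - f a l (x l)))"
proof -
  have "(\<Sum>i\<in>I. f a i ((x(l := t)) i)) = f a l t + (\<Sum>i\<in>I - {l}. f a i (x i))"
    using assms by (simp add: sum.remove[of I l])
  moreover have "(\<Sum>i\<in>I. f a i (x i)) = f a l (x l) + (\<Sum>i\<in>I - {l}. f a i (x i))"
    using assms by (simp add: sum.remove[of I l])
  ultimately show ?thesis by (simp add: resid_def)
qed

lemma C2_derivs:
  assumes "C2 g"
  shows "(g has_real_derivative deriv g t) (at t)" "(deriv g has_real_derivative deriv (deriv g) t) (at t)"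
  using assms by (auto simp: C2_def DERIV_deriv_iff_real_differentiable)

text \<open>The last node \<open>h\<close> of the support of \<open>n\<close> enters the combination only linearly, with slope
  \<open>n h\<close>. Hence \<open>h = l\<close>, and \<open>x l\<close> enters the combination linearly as well.\<close>
lemma resid_combination_linear:
  fixes n :: "nat \<Rightarrow> real"
  assumes dag: "is_dag p D" and l: "l \<in> {1..p}"
    and const: "\<And>x. x l = t0 \<Longrightarrow> (\<Sum>b\<in>{1..p}. n b * resid {1..p} mu (edge_fun D f) b x) = C"
  shows "(\<Sum>b\<in>{1..p}. n b * deriv (deriv (edge_fun D f b l)) t0) = 0"
proof (cases "\<exists>b\<in>{1..p}. n b \<noteq> 0")
  case False
  then show ?thesis by simp
next
  case True
  let ?I = "{1..p}" and ?F = "edge_fun D f"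
  \<comment> \<open>A sink of the support of \<open>n\<close>: well-foundedness of the converse
    relation yields a node all of whose children have coefficient zero.\<close>
  obtain h where h: "h \<in> ?I" "n h \<noteq> 0" and min: "\<And>b. D h b \<Longrightarrow> b \<in> ?I \<Longrightarrow> n b = 0"
    using True wfE_min[OF wf_dag(2)[OF dag], of _ "{b\<in>?I. n b \<noteq> 0}"]
    by (metis (mono_tags, lifting) mem_Collect_eq case_prod_conv converse_iff)
  have irr: "\<not> D h h" using dag by (auto simp: is_dag_def)
  have "h = l"
  proof (rule ccontr)
    assume "h \<noteq> l"
    define x where "x = (\<lambda>_::nat. t0)"
    \<comment> \<open>A unit step in \<open>x h\<close> moves the combination by \<open>n h\<close>,
      although \<open>x l\<close> stays at \<open>t0\<close> and the value should remain
      \<open>C\<close>.\<close>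
    have "n b * resid ?I mu ?F b (x(h := t0 + 1)) = n b * resid ?I mu ?F b x + (if b = h then n h else 0)" if "b \<in> ?I" for b
    proof (cases "n b = 0")
      case False
      then have "?F b h = (\<lambda>_. 0)" using min that by (auto simp: edge_fun_def)
      then show ?thesis using h by (subst resid_fun_upd) (auto simp: x_def algebra_simps)
    qed (use h in auto)
    then have "(\<Sum>b\<in>?I. n b * resid ?I mu ?F b (x(h := t0 + 1))) = (\<Sum>b\<in>?I. n b * resid ?I mu ?F b x) + n h"
      using h by (simp add: sum.distrib)
    moreover have "(\<Sum>b\<in>?I. n b * resid ?I mu ?F b (x(h := t0 + 1))) = C" "(\<Sum>b\<in>?I. n b * resid ?I mu ?F b x) = C"
      by (rule const, use \<open>h \<noteq> l\<close> in \<open>simp add: x_def\<close>)+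
    ultimately show False using h by simp
  qed
  have "n b * deriv (deriv (?F b l)) t0 = 0" if "b \<in> ?I" for b
  proof (cases "D l b")
    case True then show ?thesis using min that \<open>h = l\<close> by simp
  qed (simp add: edge_fun_def)
  then show ?thesis by (intro sum.neutral) simp
qed

section \<open>Comparison of log-densities\<close>

lemma joint_density_exp:
  assumes I: "finite I" and pos: "\<forall>j\<in>I. 0 < s2 j"
  shows "joint_density I mu f s2 x = (\<Prod>j\<in>I. 1 / sqrt (2 * pi * s2 j)) * exp (- (\<Sum>j\<in>I. (resid I mu f j x)\<^sup>2 / s2 j) / 2)"
proof -
  have "normal_density 0 (sqrt (s2 j)) y = 1 / sqrt (2 * pi * s2 j) * exp (- (y\<^sup>2 / s2 j) / 2)" if "j \<in> I" for j y
    using pos that by (auto simp: normal_density_def)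
  then have "joint_density I mu f s2 x = (\<Prod>j\<in>I. 1 / sqrt (2 * pi * s2 j) * exp (- ((resid I mu f j x)\<^sup>2 / s2 j) / 2))"
    unfolding joint_density_def by (intro prod.cong) auto
  also have "\<dots> = (\<Prod>j\<in>I. 1 / sqrt (2 * pi * s2 j)) * exp (\<Sum>j\<in>I. - ((resid I mu f j x)\<^sup>2 / s2 j) / 2)"
    using I by (simp only: prod.distrib exp_sum)
  also have "(\<Sum>j\<in>I. - ((resid I mu f j x)\<^sup>2 / s2 j) / 2) = - (\<Sum>j\<in>I. (resid I mu f j x)\<^sup>2 / s2 j) / 2"
    by (simp add: sum_negf sum_divide_distrib)
  finally show ?thesis .
qed

lemma joint_density_continuous:
  assumes "finite I" "\<And>i j. C2 (f j i)"
  shows "continuous_on UNIV (joint_density I mu f s2)"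
proof -
  have r: "continuous_on UNIV (resid I mu f j)" for j
    unfolding resid_def[abs_def]
    by (intro continuous_intros continuous_on_compose2[OF C2_continuous[OF assms(2)]]) auto
  have "continuous_on UNIV (normal_density 0 s)" for s
    unfolding normal_density_def[abs_def] divide_inverse by (intro continuous_intros)
  from continuous_on_compose2[OF this r] show ?thesis
    unfolding joint_density_def[abs_def] by (intro continuous_on_prod) auto
qed

text \<open>Carries the equality of densities from extensional points to all functions, on which the
  later differentiation takes place.\<close>

lemma joint_density_restrict: "joint_density I mu f s2 (restrict x I) = joint_density I mu f s2 x"
  unfolding joint_density_def resid_def by (intro prod.cong refl arg_cong2[where f="normal_density 0"] arg_cong2[where f="(-)"] sum.cong) auto

text \<open>The continuous densities agree pointwise; taking logarithms leaves the two quadratic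
  expressions and the constants of normalisation.\<close>

lemma resid_squares_agree:
  assumes gen: "generates p P D mu f s2" and gen': "generates p P D' mu' f' s2'"
  shows "\<exists>c. \<forall>x. (\<Sum>j\<in>{1..p}. (resid {1..p} mu' (edge_fun D' f') j x)\<^sup>2 / s2' j)
    = (\<Sum>j\<in>{1..p}. (resid {1..p} mu (edge_fun D f) j x)\<^sup>2 / s2 j) + c"
proof -
  let ?I = "{1..p}"
  let ?d = "joint_density ?I mu (edge_fun D f) s2" and ?d' = "joint_density ?I mu' (edge_fun D' f') s2'"
  have pos: "\<forall>j\<in>?I. 0 < s2 j" "\<forall>j\<in>?I. 0 < s2' j"
    using gen gen' unfolding generates_def by blast+
  have C: "C2 (edge_fun D f j i)" "C2 (edge_fun D' f' j i)" for i j
    using C2_edge_fun gen gen' by blast+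
  have P: "P = density (PiM ?I (\<lambda>_. lborel)) (\<lambda>x. ennreal (?d x))"
    using generates_solution[OF gen] by blast
  have P': "P = density (PiM ?I (\<lambda>_. lborel)) (\<lambda>x. ennreal (?d' x))"
    using generates_solution[OF gen'] by blast
  have "?d (restrict x ?I) = ?d' (restrict x ?I)" for x
  proof (rule density_eq_imp_eq[where I="?I" and d="?d" and d'="?d'"])
    show "?d \<in> borel_measurable (PiM ?I (\<lambda>_. borel))" "?d' \<in> borel_measurable (PiM ?I (\<lambda>_. borel))"
      by (intro joint_density_measurable C2_measurable C)+
    show "density (PiM ?I (\<lambda>_. lborel)) (\<lambda>x. ennreal (?d x)) = density (PiM ?I (\<lambda>_. lborel)) (\<lambda>x. ennreal (?d' x))"
      using P P' by simp
  qed (auto intro: joint_density_nonneg joint_density_continuous C)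
  then have eq: "?d x = ?d' x" for x by (simp only: joint_density_restrict)
  define A where "A = (\<Prod>j\<in>?I. 1 / sqrt (2 * pi * s2 j))"
  define A' where "A' = (\<Prod>j\<in>?I. 1 / sqrt (2 * pi * s2' j))"
  have A: "0 < A" "0 < A'" unfolding A_def A'_def using pos by (auto intro!: prod_pos)
  let ?q = "\<lambda>x. \<Sum>j\<in>?I. (resid ?I mu (edge_fun D f) j x)\<^sup>2 / s2 j"
  let ?q' = "\<lambda>x. \<Sum>j\<in>?I. (resid ?I mu' (edge_fun D' f') j x)\<^sup>2 / s2' j"
  have "?q' x = ?q x + 2 * (ln A' - ln A)" for x
  proof -
    have "A * exp (- ?q x / 2) = A' * exp (- ?q' x / 2)"
      using eq[of x] joint_density_exp[of ?I s2 mu "edge_fun D f" x] joint_density_exp[of ?I s2' mu' "edge_fun D' f'" x] pos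
      unfolding A_def A'_def by simp
    then have "ln (A * exp (- ?q x / 2)) = ln (A' * exp (- ?q' x / 2))" by (rule arg_cong)
    moreover have "ln (A * exp (- ?q x / 2)) = ln A - ?q x / 2" "ln (A' * exp (- ?q' x / 2)) = ln A' - ?q' x / 2"
      using A by (simp_all only: ln_mult_pos exp_gt_zero ln_exp)
    ultimately have "ln A - ?q x / 2 = ln A' - ?q' x / 2" by (simp only:)
    moreover have "b = a + 2 * (v - u)" if "u - a / 2 = v - b / 2" for a b u v :: real
      using that by simp
    ultimately show ?thesis by blast
  qed
  then show ?thesis by blast
qed

text \<open>Along a causal order of \<open>D'\<close> the last remaining node is a sink.
  \<open>peel_sink\<close> makes its residual a combination of the \<open>?r b\<close>; removing its
  square leaves a quadratic form in the same residuals, so the induction continues.\<close>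

theorem resid_linear_dependence:
  assumes gen: "generates p P D mu f s2" and gen': "generates p P D' mu' f' s2'" and "l \<in> {1..p}"
  shows "\<exists>w. \<forall>x. resid {1..p} mu' (edge_fun D' f') l x = (\<Sum>b\<in>{1..p}. w b * resid {1..p} mu (edge_fun D f) b x)"
proof -
  let ?I = "{1..p}"
  let ?r = "resid ?I mu (edge_fun D f)" and ?g = "resid ?I mu' (edge_fun D' f')"
  \<comment> \<open>\<open>\<phi> l a\<close> collects the dependence of the residual of
    \<open>a\<close> on the coordinate \<open>l\<close>; the next two are its derivatives.\<close>
  define \<phi> where "\<phi> l a t = (if a = l then t else 0) - edge_fun D f a l t" for l a :: nat and t
  define \<phi>' where "\<phi>' l a t = (if a = l then 1 else 0) - deriv (edge_fun D f a l) t" for l a :: nat and t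
  define \<phi>'' where "\<phi>'' l a t = - deriv (deriv (edge_fun D f a l)) t" for l a :: nat and t
  have dag: "is_dag p D" and dag': "is_dag p D'" and pos': "\<forall>j\<in>?I. 0 < s2' j"
    using gen gen' unfolding generates_def by blast+
  \<comment> \<open>The solution at noise \<open>u\<close> is a point with residuals
    \<open>u\<close>.\<close>
  have surj: "\<exists>x. \<forall>a\<in>?I. ?r a x = u a" for u
    using generates_solution[OF gen] by metis
  have \<phi>: "(\<phi> l a has_real_derivative \<phi>' l a t) (at t)" "(\<phi>' l a has_real_derivative \<phi>'' l a t) (at t)" for l a t
    unfolding \<phi>_def[abs_def] \<phi>'_def[abs_def] \<phi>''_def
    by (auto intro!: derivative_eq_intros C2_derivs C2_edge_fun[OF gen])
  have r: "?r a (x(l := t)) = ?r a x + (\<phi> l a t - \<phi> l a (x l))" if "l \<in> ?I" for l a x t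
    unfolding \<phi>_def using that by (intro resid_fun_upd) auto
  have tri: "(\<Sum>b\<in>?I. n b * \<phi>'' l b t0) = 0"
    if "l \<in> ?I" "\<And>x. x l = t0 \<Longrightarrow> (\<Sum>b\<in>?I. n b * ?r b x) = C" for n C l t0
    using resid_combination_linear[OF dag that(1), of t0 n mu f C] that(2) by (simp add: \<phi>''_def sum_negf)
  obtain xs where xs: "distinct xs" "set xs = ?I" "sorted_wrt (\<lambda>a b. \<not> D' b a) xs"
    using topological_sort[OF dag', of ?I] by auto
  \<comment> \<open>The matrix \<open>K\<close> is general because each peeling changes it; only
    symmetry and the identity with constant \<open>c\<close> persist.\<close>
  have "\<forall>m\<in>set us. \<exists>w. \<forall>x. ?g m x = (\<Sum>b\<in>?I. w b * ?r b x)"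
    if "set us \<subseteq> ?I" "distinct us" "sorted_wrt (\<lambda>a b. \<not> D' b a) us"
      and "\<And>a b. K a b = K b a"
      and "\<And>x. (\<Sum>m\<in>set us. (?g m x)\<^sup>2 / s2' m) = bform ?I K (\<lambda>a. ?r a x) (\<lambda>a. ?r a x) + c"
    for us K c
    using that
  proof (induction us arbitrary: K rule: rev_induct)
    case Nil
    then show ?case by simp
  next
    case (snoc l us)
    have l: "l \<in> ?I" and lus: "l \<notin> set us" and nD: "\<And>m. m \<in> set us \<Longrightarrow> \<not> D' l m"
      and usI: "set us \<subseteq> ?I"
      using snoc.prems(1-3) by (auto simp: sorted_wrt_append)
    have sym: "K a b = K b a" for a b by (rule snoc.prems(4))
    have eq: "(\<Sum>m\<in>insert l (set us). (?g m x)\<^sup>2 / s2' m) = bform ?I K (\<lambda>a. ?r a x) (\<lambda>a. ?r a x) + c" for x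
      using snoc.prems(5)[of x] by simp
    have irr: "\<not> D' l l" using dag' by (auto simp: is_dag_def)
    have gS: "?g m (x(l := t)) = ?g m x" if "m \<in> set us" for m x t
      using nD[OF that] lus that l by (subst resid_fun_upd) (auto simp: edge_fun_def)
    have gl: "?g l (x(l := t)) = ?g l x + (t - x l)" for x t
      using irr l by (subst resid_fun_upd) (auto simp: edge_fun_def)
    have "\<exists>w. \<forall>x. ?g l x = (\<Sum>b\<in>?I. w b * ?r b x)"
    proof (rule peel_sink[where S="set us" and K=K and v=s2' and c=c and l=l and \<phi>="\<phi> l" and \<phi>'="\<phi>' l" and \<phi>''="\<phi>'' l"])
      show "0 < s2' m" if "m \<in> insert l (set us)" for m using pos' that l usI by blast
      show "(\<Sum>b\<in>?I. n b * \<phi>'' l b t0) = 0"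
        if "\<And>x. x l = t0 \<Longrightarrow> (\<Sum>b\<in>?I. n b * ?r b x) = C" for n C t0
        using tri[OF l that] .
    qed (fact surj lus sym eq gS gl finite_set finite_atLeastAtMost | rule r[OF l] \<phi>)+
    then obtain w where w: "\<And>x. ?g l x = (\<Sum>b\<in>?I. w b * ?r b x)" by blast
    \<comment> \<open>Subtracts the rank-one form of the peeled square.\<close>
    define K' where "K' a b = K a b - w a * w b / s2' l" for a b
    have "(\<Sum>m\<in>set us. (?g m x)\<^sup>2 / s2' m) = bform ?I K' (\<lambda>a. ?r a x) (\<lambda>a. ?r a x) + c" for x
    proof -
      have "(?g l x)\<^sup>2 = (\<Sum>a\<in>?I. \<Sum>b\<in>?I. (w a * ?r a x) * (w b * ?r b x))"
        unfolding w power2_eq_square sum_product ..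
      then have "(?g l x)\<^sup>2 / s2' l = (\<Sum>a\<in>?I. \<Sum>b\<in>?I. (w a * w b / s2' l) * ?r a x * ?r b x)"
        by (simp add: sum_divide_distrib mult_ac)
      then have "bform ?I K' (\<lambda>a. ?r a x) (\<lambda>a. ?r a x) = bform ?I K (\<lambda>a. ?r a x) (\<lambda>a. ?r a x) - (?g l x)\<^sup>2 / s2' l"
        by (simp add: bform_def K'_def left_diff_distrib sum_subtractf)
      then show ?thesis using eq[of x] lus by simp
    qed
    moreover have "K' a b = K' b a" for a b using sym[of a b] by (simp add: K'_def mult.commute)
    moreover have "distinct us" "sorted_wrt (\<lambda>a b. \<not> D' b a) us" using snoc.prems by (auto simp: sorted_wrt_append)
    ultimately have "\<forall>m\<in>set us. \<exists>w. \<forall>x. ?g m x = (\<Sum>b\<in>?I. w b * ?r b x)"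
      using snoc.IH[OF usI, of K'] by blast
    then show ?case using w by auto
  qed
  note * = this
  obtain c where c: "\<And>x. (\<Sum>j\<in>?I. (?g j x)\<^sup>2 / s2' j) = (\<Sum>j\<in>?I. (?r j x)\<^sup>2 / s2 j) + c"
    using resid_squares_agree[OF gen gen'] by blast
  \<comment> \<open>The starting form is diagonal with the inverse variances of the first
    PLSEM.\<close>
  define K0 where "K0 a b = (if a = b then 1 / s2 a else 0)" for a b
  have "bform ?I K0 u u = (\<Sum>j\<in>?I. (u j)\<^sup>2 / s2 j)" for u
  proof -
    have "(\<Sum>b\<in>?I. K0 a b * u a * u b) = (u a)\<^sup>2 / s2 a" if "a \<in> ?I" for a
    proof -
      have "(\<Sum>b\<in>?I. K0 a b * u a * u b) = (\<Sum>b\<in>?I. if a = b then (u a)\<^sup>2 / s2 a else 0)"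
        by (intro sum.cong) (auto simp: K0_def power2_eq_square)
      then show ?thesis using that by simp
    qed
    then show ?thesis unfolding bform_def by (intro sum.cong) auto
  qed
  then have "(\<Sum>m\<in>set xs. (?g m x)\<^sup>2 / s2' m) = bform ?I K0 (\<lambda>a. ?r a x) (\<lambda>a. ?r a x) + c" for x
    unfolding xs(2) using c[of x] by simp
  moreover have "K0 a b = K0 b a" for a b by (simp add: K0_def)
  ultimately show ?thesis using *[of xs K0 c] xs \<open>l \<in> ?I\<close> by auto
qed

section \<open>Reversing linear edges\<close>

lemma prob_space_normal_noise: "0 < s2 j \<Longrightarrow> prob_space (normal_noise s2 j)"
  by (rule prob_space_normal_density) simp

text \<open>Variance one at all other indices makes every factor a probability measure, as
  \<open>product_prob_space\<close> asks.\<close>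

lemma noise_space_extend:
  "noise_space p s2 = PiM {1..p} (normal_noise (\<lambda>j. if j \<in> {1..p} then s2 j else 1))"
  unfolding noise_space_def by (intro PiM_cong) auto

lemma prob_space_noise_space:
  assumes "\<forall>j\<in>{1..p}. 0 < s2 j"
  shows "prob_space (noise_space p s2)"
  unfolding noise_space_def using assms by (intro prob_space_PiM prob_space_normal_noise) auto

lemma noise_component_mean:
  assumes pos: "\<forall>j\<in>{1..p}. 0 < s2 j" and j: "j \<in> {1..p}"
  shows "integrable (noise_space p s2) (\<lambda>e. e j)" "(\<integral>e. e j \<partial>noise_space p s2) = 0"
proof -
  define s where "s j = (if j \<in> {1..p} then s2 j else 1)" for j
  interpret prob_space "normal_noise s i" for i
    by (rule prob_space_normal_noise) (use pos in \<open>auto simp: s_def\<close>)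
  interpret product_prob_space "normal_noise s" "{1..p}" by standard
  have N: "noise_space p s2 = PiM {1..p} (normal_noise s)"
    unfolding noise_space_extend s_def[abs_def] ..
  have d: "distr (noise_space p s2) (normal_noise s j) (\<lambda>e. e j) = normal_noise s j"
    unfolding N by (rule PiM_component[OF j])
  have m: "(\<lambda>e. e j) \<in> measurable (noise_space p s2) (normal_noise s j)"
    unfolding N by (rule measurable_component_singleton[OF j])
  have i: "has_bochner_integral (normal_noise s j) (\<lambda>t. t) 0"
  proof (rule has_bochner_integral_density)
    have "0 < sqrt (s j)" using pos by (auto simp: s_def)
    from normal_moment_nz_1[OF this, of 0]
    show "has_bochner_integral lborel (\<lambda>t. normal_density 0 (sqrt (s j)) t *\<^sub>R t) 0" by simp
  qed auto
  show "integrable (noise_space p s2) (\<lambda>e. e j)"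
    using i integrable_distr_eq[OF m, of "\<lambda>t. t"] unfolding d
    by (simp add: has_bochner_integral_iff)
  show "(\<integral>e. e j \<partial>noise_space p s2) = 0"
    using i integral_distr[OF m, of "\<lambda>t. t"] unfolding d
    by (simp add: has_bochner_integral_iff)
qed

text \<open>In the structural equation the edge functions and the noise are centred, leaving
  \<open>mu j\<close>. This identifies which affine functions have mean zero when an edge is
  reversed.\<close>

lemma plsem_law_mean:
  assumes law: "plsem_law p P mu f s2" and co: "causal_order xs f" and xs: "set xs = {1..p}" and j: "j \<in> {1..p}"
  shows "integrable P (\<lambda>x. x j)" "(\<integral>x. x j \<partial>P) = mu j"
proof -
  let ?I = "{1..p}"
  have pos: "\<forall>j\<in>?I. 0 < s2 j" using law unfolding plsem_law_def by blast
  have C: "C2 (f j i)" and E: "integrable P (\<lambda>x. f j i (x i))" "(\<integral>x. f j i (x i) \<partial>P) = 0" for i j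
    using law unfolding plsem_law_def by blast+
  have ef: "edge_fun (support_graph p f) f j i = f j i" if "i \<in> ?I" "j \<in> ?I" for i j
    using that by (auto simp: edge_fun_def support_graph_def)
  obtain X where X: "X \<in> measurable (PiM ?I (\<lambda>_. borel)) (PiM ?I (\<lambda>_. borel))"
    and r: "\<And>e j. j \<in> ?I \<Longrightarrow> resid ?I mu (edge_fun (support_graph p f) f) j (X e) = e j"
    and PX: "P = distr (noise_space p s2) (PiM ?I (\<lambda>_. borel)) X"
    using generates_solution[OF plsem_law_imp_generates[OF law co xs]] by metis
  have Xm: "X \<in> measurable (noise_space p s2) (PiM ?I (\<lambda>_. borel))"
    using X unfolding noise_space_def by (simp cong: measurable_cong_sets add: sets_PiM_normal_noise)
  have Xj: "X e j = mu j + (\<Sum>i\<in>?I. f j i (X e i)) + e j" for e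
  proof -
    have "(\<Sum>i\<in>?I. edge_fun (support_graph p f) f j i (X e i)) = (\<Sum>i\<in>?I. f j i (X e i))"
      using ef j by (intro sum.cong) auto
    then show ?thesis using r[OF j, of e] by (simp add: resid_def)
  qed
  interpret prob_space "noise_space p s2" by (rule prob_space_noise_space[OF pos])
  have m: "(\<lambda>x. f j i (x i)) \<in> borel_measurable (PiM ?I (\<lambda>_. borel))" if "i \<in> ?I" for i
    using that C by (intro measurable_PiM_coordinate C2_measurable)
  have F: "integrable (noise_space p s2) (\<lambda>e. f j i (X e i))" "(\<integral>e. f j i (X e i) \<partial>noise_space p s2) = 0" if "i \<in> ?I" for i
    using E[of j i] unfolding PX integrable_distr_eq[OF Xm m[OF that]] integral_distr[OF Xm m[OF that]] by auto
  have mj: "(\<lambda>x. x j) \<in> borel_measurable (PiM ?I (\<lambda>_. borel))"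
    using measurable_component_singleton[OF j] .
  have "has_bochner_integral (noise_space p s2) (\<lambda>e. X e j) (mu j + (\<Sum>i\<in>?I. 0) + 0)"
    unfolding Xj
    by (intro has_bochner_integral_add has_bochner_integral_sum)
       (use F noise_component_mean[OF pos j] in \<open>simp_all add: has_bochner_integral_iff prob_space\<close>)
  then show "integrable P (\<lambda>x. x j)" "(\<integral>x. x j \<partial>P) = mu j"
    unfolding PX integrable_distr_eq[OF Xm mj] integral_distr[OF Xm mj] by (simp_all add: has_bochner_integral_iff)
qed

text \<open>For independent centred Gaussians \<open>a\<close>, \<open>b\<close> of variances
  \<open>s\<close>, \<open>v\<close>, the sum \<open>b + \<beta> * a\<close> has variance
  \<open>w\<close>, and \<open>\<beta> * s / w\<close> is the regression coefficient of
  \<open>a\<close> on it. The regression residual has variance \<open>s * v / w\<close> and is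
  independent of the sum.\<close>

lemma normal_density_pair_rotate:
  assumes s: "0 < s" and v: "0 < v" and w: "w = v + \<beta>\<^sup>2 * s"
  shows "normal_density 0 (sqrt s) a * normal_density 0 (sqrt v) b
    = normal_density 0 (sqrt (s * v / w)) (a - \<beta> * s / w * (b + \<beta> * a)) * normal_density 0 (sqrt w) (b + \<beta> * a)"
proof -
  have wpos: "0 < w" using s v w by (simp add: add_pos_nonneg)
  have nd: "normal_density 0 (sqrt u) t = inverse (sqrt (2 * pi)) * inverse (sqrt u) * exp (- (t\<^sup>2 / u / 2))" if "0 < u" for u t
    using that by (simp add: normal_density_def real_sqrt_mult field_simps)
  \<comment> \<open>The exponents agree by completing the square.\<close>
  have "a\<^sup>2 / s + b\<^sup>2 / v = (a - \<beta> * s / w * (b + \<beta> * a))\<^sup>2 / (s * v / w) + (b + \<beta> * a)\<^sup>2 / w"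
  proof -
    have eq: "a - \<beta> * s / w * (b + \<beta> * a) = (v * a - \<beta> * s * b) / w"
      using wpos by (simp add: field_simps w power2_eq_square)
    have "(A / w)\<^sup>2 / (s * v / w) + B\<^sup>2 / w = (A\<^sup>2 + s * v * B\<^sup>2) / (s * v * w)" for A B
      using s v wpos by (simp add: field_simps power2_eq_square)
    then have "(a - \<beta> * s / w * (b + \<beta> * a))\<^sup>2 / (s * v / w) + (b + \<beta> * a)\<^sup>2 / w
      = ((v * a - \<beta> * s * b)\<^sup>2 + s * v * (b + \<beta> * a)\<^sup>2) / (s * v * w)"
      unfolding eq .
    also have "(v * a - \<beta> * s * b)\<^sup>2 + s * v * (b + \<beta> * a)\<^sup>2 = w * (v * a\<^sup>2 + s * b\<^sup>2)"
      by (simp add: w power2_eq_square algebra_simps)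
    also have "w * (v * a\<^sup>2 + s * b\<^sup>2) / (s * v * w) = a\<^sup>2 / s + b\<^sup>2 / v"
      using s v wpos by (simp add: field_simps)
    finally show ?thesis by simp
  qed
  note sq = this
  have ex: "exp (- (t / 2)) * exp (- (u / 2)) = exp (- (t' / 2)) * exp (- (u' / 2))" if "t + u = t' + u'" for t u t' u' :: real
    unfolding exp_add[symmetric] using that by simp
  \<comment> \<open>The normalisations agree because the two variance products are equal.\<close>
  have sw: "inverse (sqrt s) * inverse (sqrt v) = inverse (sqrt (s * v / w)) * inverse (sqrt w)"
    using s v wpos by (simp add: real_sqrt_mult real_sqrt_divide field_simps)
  have ac: "(k * x1 * e1) * (k * x2 * e2) = (k * y1 * f1) * (k * y2 * f2)"
    if "x1 * x2 = y1 * y2" "e1 * e2 = f1 * f2" for k x1 x2 y1 y2 e1 e2 f1 f2 :: real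
  proof -
    have "(k * x1 * e1) * (k * x2 * e2) = k * k * (x1 * x2) * (e1 * e2)" by (simp add: mult_ac)
    also have "\<dots> = (k * y1 * f1) * (k * y2 * f2)" unfolding that by (simp add: mult_ac)
    finally show ?thesis .
  qed
  have swp: "0 < s * v / w" using s v wpos by simp
  show ?thesis unfolding nd[OF s] nd[OF v] nd[OF wpos] nd[OF swp] by (rule ac[OF sw ex[OF sq]])
qed

lemma C2_scale: "C2 g \<Longrightarrow> C2 (\<lambda>t. c * g t)"
  and C2_add: "C2 g \<Longrightarrow> C2 h \<Longrightarrow> C2 (\<lambda>t. g t + h t)"
  and C2_affine: "C2 (\<lambda>t. c * (t - m))"
proof -
  have D: "deriv g = g'" if "\<And>t. (g has_real_derivative g' t) (at t)" for g g'
    using that by (auto intro: DERIV_imp_deriv)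
  have mk: "C2 g" if "\<And>t. (g has_real_derivative g' t) (at t)" "\<And>t. (g' has_real_derivative g'' t) (at t)" "continuous_on UNIV g''" for g g' g''
    using that D[OF that(1)] D[OF that(2)] by (auto simp: C2_def real_differentiable_def)
  have E: "(g has_real_derivative deriv g t) (at t)" "(deriv g has_real_derivative deriv (deriv g) t) (at t)" "continuous_on UNIV (deriv (deriv g))" if "C2 g" for g t
    using that by (auto simp: C2_def DERIV_deriv_iff_real_differentiable)
  show "C2 g \<Longrightarrow> C2 (\<lambda>t. c * g t)"
    by (rule mk[of _ "\<lambda>t. c * deriv g t" "\<lambda>t. c * deriv (deriv g) t"]) (auto intro!: derivative_eq_intros E continuous_intros)
  show "C2 g \<Longrightarrow> C2 h \<Longrightarrow> C2 (\<lambda>t. g t + h t)"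
    by (rule mk[of _ "\<lambda>t. deriv g t + deriv h t" "\<lambda>t. deriv (deriv g) t + deriv (deriv h) t"]) (auto intro!: derivative_eq_intros E continuous_intros)
  show "C2 (\<lambda>t. c * (t - m))"
    by (rule mk[of _ "\<lambda>t. c" "\<lambda>t. 0"]) (auto intro!: derivative_eq_intros)
qed

lemma C2_linear:
  assumes "C2 g" "deriv (deriv g) = (\<lambda>_. 0)"
  obtains \<alpha> \<beta> where "\<And>t. g t = \<alpha> + \<beta> * t"
proof -
  have E: "(g has_real_derivative deriv g t) (at t)" "(deriv g has_real_derivative deriv (deriv g) t) (at t)" for t
    using assms(1) by (simp_all add: C2_def DERIV_deriv_iff_real_differentiable)
  then have c: "deriv g t = deriv g 0" for t
    by (intro DERIV_isconst_all allI) (use E(2) assms(2) in simp)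
  have "((\<lambda>t. g t - deriv g 0 * t) has_real_derivative 0) (at t)" for t
  proof -
    have "(g has_real_derivative deriv g 0) (at t)" using E(1)[of t] c[of t] by metis
    then show ?thesis by (rule DERIV_cong[OF DERIV_diff[OF _ DERIV_cmult_Id]]) simp
  qed
  then have "g t - deriv g 0 * t = g 0 - deriv g 0 * 0" for t
    using DERIV_isconst_all[of "\<lambda>t. g t - deriv g 0 * t" t 0] by simp
  then have "g t = g 0 + deriv g 0 * t" for t
    by (metis add.commute diff_add_cancel diff_zero mult_zero_right)
  then show thesis by (rule that)
qed

lemma generates_prob_space:
  assumes gen: "generates p P D mu f s2"
  shows "prob_space P"
proof -
  have pos: "\<forall>j\<in>{1..p}. 0 < s2 j" using gen unfolding generates_def by blast
  interpret N: prob_space "noise_space p s2" by (rule prob_space_noise_space[OF pos])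
  show ?thesis using gen unfolding generates_def by (metis N.prob_space_distr)
qed

lemma if_mult_sum_delta:
  fixes a :: "'b :: comm_semiring_1"
  assumes "finite I" "k \<in> I"
  shows "(\<Sum>n\<in>I. (if n = k then a else 0) * g n) = a * g k"
  using assms by (simp add: if_distrib[of "\<lambda>u. u * _"] cong: if_cong)

text \<open>Two noises \<open>r i, r l\<close> of consecutive nodes are replaced by the rotated pair
  \<open>r l + \<beta> * r i\<close> and \<open>r i - c * (r l + \<beta> * r i)\<close>, in which \<open>x i\<close> cancels from the
  equation of \<open>l\<close>.\<close>
lemma swap_linear_neighbours:
  assumes law: "plsem_law p P mu f s2" and co: "causal_order (as @ i # l # bs) f"
    and xs: "set (as @ i # l # bs) = {1..p}" and lin: "deriv (deriv (f l i)) = (\<lambda>_. 0)"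
  shows "\<exists>f' s2'. plsem_law p P mu f' s2' \<and> causal_order (as @ l # i # bs) f' \<and> (\<forall>m. m \<noteq> l \<longrightarrow> f' m i = f m i)"
proof -
  let ?I = "{1..p}"
  have iI: "i \<in> ?I" and lI: "l \<in> ?I" using xs by auto
  have z: "f i i = (\<lambda>_. 0)" "f l l = (\<lambda>_. 0)" "f i l = (\<lambda>_. 0)" and il: "i \<noteq> l"
    using co by (auto simp: causal_order_def sorted_wrt_append)
  have pos: "\<forall>j\<in>?I. 0 < s2 j" and C: "\<And>i j. C2 (f j i)"
    and E: "\<And>i j. integrable P (\<lambda>x. f j i (x i))" "\<And>i j. (\<integral>x. f j i (x i) \<partial>P) = 0"
    and P: "P = density (PiM ?I (\<lambda>_. lborel)) (\<lambda>x. ennreal (joint_density ?I mu f s2 x))"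
    using law unfolding plsem_law_def by blast+
  note mean = plsem_law_mean[OF law co xs]
  obtain \<alpha> \<beta> where ab: "\<And>t. f l i t = \<alpha> + \<beta> * t" using C2_linear[OF C lin] by blast
  interpret prob_space P by (rule generates_prob_space[OF plsem_law_imp_generates[OF law co xs]])
  \<comment> \<open>The mean-zero condition fixes the intercept of the linear edge function.\<close>
  have "f l i = (\<lambda>t. \<beta> * (t - mu i))"
  proof -
    have "0 = (\<integral>x. \<alpha> + \<beta> * x i \<partial>P)" using E(2)[of l i] unfolding ab by simp
    also have "\<dots> = \<alpha> + \<beta> * mu i" using mean[OF iI] by (simp add: prob_space)
    finally have "\<alpha> + \<beta> * mu i = 0" by simp
    then show ?thesis unfolding fun_eq_iff ab by (simp add: algebra_simps)
  qed
  note fli = this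
  define s v where "s = s2 i" and "v = s2 l"
  define w where "w = v + \<beta>\<^sup>2 * s"
  define c where "c = \<beta> * s / w"
  have sv: "0 < s" "0 < v" using pos iI lI by (auto simp: s_def v_def)
  then have wp: "0 < w" by (simp add: w_def add_pos_nonneg)
  \<comment> \<open>Reads \<open>r l + \<beta> * r i\<close> as a new equation for \<open>l\<close>:
    the term \<open>\<beta> * x i\<close> from the residual of \<open>i\<close> is absorbed at index
    \<open>i\<close>, where it cancels \<open>f l i\<close>.\<close>
  define gl where "gl n t = f l n t + \<beta> * f i n t + (if n = i then - \<beta> else 0) * (t - mu n)" for n t
  \<comment> \<open>Reads \<open>r i\<close> minus \<open>c\<close> times the new residual of
    \<open>l\<close> as an equation for \<open>i\<close>; the new edge from \<open>l\<close> to
    \<open>i\<close> is \<open>c * (t - mu l)\<close>.\<close>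
  define gi where "gi n t = f i n t + (- c) * gl n t + (if n = l then c else 0) * (t - mu n)" for n t
  define f' where "f' = f(l := gl, i := gi)"
  define s2' where "s2' = s2(l := w, i := s * v / w)"
  have f'l: "f' l = gl" and f'i: "f' i = gi" and f'm: "m \<noteq> l \<Longrightarrow> m \<noteq> i \<Longrightarrow> f' m = f m" for m
    using il by (simp_all add: f'_def)
  have gl0: "gl i = (\<lambda>_. 0)" "gl l = (\<lambda>_. 0)" using il by (simp_all add: gl_def[abs_def] fli z)
  have gi0: "gi i = (\<lambda>_. 0)" using il gl0 fun_cong[OF gl0(1)] by (simp add: gi_def[abs_def] z)
  have glz: "gl n = (\<lambda>_. 0)" if "f l n = (\<lambda>_. 0)" "f i n = (\<lambda>_. 0)" "n \<noteq> i" for n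
    using that by (simp add: gl_def[abs_def])
  have giz: "gi n = (\<lambda>_. 0)" if "f l n = (\<lambda>_. 0)" "f i n = (\<lambda>_. 0)" "n \<noteq> i" "n \<noteq> l" for n
    using that fun_cong[OF glz[OF that(1-3)]] by (simp add: gi_def[abs_def])
  have co': "causal_order (as @ l # i # bs) f'"
  proof -
    have bs: "gl n = (\<lambda>_. 0)" "gi n = (\<lambda>_. 0)" if "n \<in> set bs" for n
    proof -
      have "f l n = (\<lambda>_. 0)" "f i n = (\<lambda>_. 0)" "n \<noteq> i" "n \<noteq> l"
        using co that by (auto simp: causal_order_def sorted_wrt_append)
      then show "gl n = (\<lambda>_. 0)" "gi n = (\<lambda>_. 0)" using glz giz by blast+
    qed
    have "sorted_wrt (\<lambda>a b. f' a b = (\<lambda>_. 0)) zs"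
      if "sorted_wrt (\<lambda>a b. f a b = (\<lambda>_. 0)) zs" "i \<notin> set zs" "l \<notin> set zs" for zs
      using that(1) by (rule sorted_wrt_mono_rel[rotated]) (use that(2,3) f'm in metis)
    note sorted = this[of as] this[of bs]
    have "f' x = f x" if "x \<in> set as \<union> set bs" for x
      using that co f'm[of x] by (auto simp: causal_order_def)
    with sorted co bs gl0 gi0 il
    show ?thesis unfolding causal_order_def
      by (auto simp: sorted_wrt_append f'l f'i)
  qed
  \<comment> \<open>The added linear terms are centred at the means of the coordinates, so the
    moment conditions survive with \<open>mu\<close> unchanged.\<close>
  have affine_mean: "has_bochner_integral P (\<lambda>x. (if n = k then a else 0) * (x n - mu n)) 0" if "k \<in> ?I" for n k and a :: real
  proof -
    have "has_bochner_integral P (\<lambda>x. a * (x k - mu k)) (a * (mu k - mu k))"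
      using mean[OF that]
      by (intro has_bochner_integral_mult_right has_bochner_integral_diff) (simp_all add: has_bochner_integral_iff prob_space)
    then show ?thesis by (cases "n = k") (simp_all add: has_bochner_integral_zero)
  qed
  have f_mean: "has_bochner_integral P (\<lambda>x. f j n (x n)) 0" for j n
    using E by (simp add: has_bochner_integral_iff)
  have gl_mean: "has_bochner_integral P (\<lambda>x. gl n (x n)) 0" for n
  proof -
    have "has_bochner_integral P (\<lambda>x. f l n (x n) + \<beta> * f i n (x n) + (if n = i then - \<beta> else 0) * (x n - mu n)) (0 + \<beta> * 0 + 0)"
      by (intro has_bochner_integral_add has_bochner_integral_mult_right f_mean affine_mean iI) 
    then show ?thesis by (simp add: gl_def)
  qed
  have gi_mean: "has_bochner_integral P (\<lambda>x. gi n (x n)) 0" for n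
  proof -
    have "has_bochner_integral P (\<lambda>x. f i n (x n) + (- c) * gl n (x n) + (if n = l then c else 0) * (x n - mu n)) (0 + (- c) * 0 + 0)"
      by (intro has_bochner_integral_add has_bochner_integral_mult_right f_mean gl_mean affine_mean lI) 
    then show ?thesis by (simp add: gi_def)
  qed
  have f'_mean: "has_bochner_integral P (\<lambda>x. f' j n (x n)) 0" for j n
    by (simp add: f'_def gl_mean gi_mean f_mean)
  have glC: "C2 (gl n)" for n
    unfolding gl_def[abs_def] by (intro C2_add C2_scale C2_affine C)
  have giC: "C2 (gi n)" for n
    unfolding gi_def[abs_def] by (intro C2_add C2_scale C2_affine C glC)
  have f'C: "C2 (f' j n)" for j n
    by (simp add: f'_def glC giC C)
  have rl: "resid ?I mu f' l x = resid ?I mu f l x + \<beta> * resid ?I mu f i x" for x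
  proof -
    have "(\<Sum>n\<in>?I. gl n (x n)) = (\<Sum>n\<in>?I. f l n (x n)) + \<beta> * (\<Sum>n\<in>?I. f i n (x n)) + - \<beta> * (x i - mu i)"
      unfolding gl_def sum.distrib if_mult_sum_delta[OF finite_atLeastAtMost iI, of "- \<beta>" "\<lambda>n. x n - mu n"] sum_distrib_left ..
    then show ?thesis unfolding resid_def f'l by (simp add: algebra_simps)
  qed
  have ri: "resid ?I mu f' i x = resid ?I mu f i x - c * (resid ?I mu f l x + \<beta> * resid ?I mu f i x)" for x
  proof -
    have "(\<Sum>n\<in>?I. gi n (x n)) = (\<Sum>n\<in>?I. f i n (x n)) + (- c) * (\<Sum>n\<in>?I. gl n (x n)) + c * (x l - mu l)"
      unfolding gi_def sum.distrib if_mult_sum_delta[OF finite_atLeastAtMost lI, of c "\<lambda>n. x n - mu n"] sum_distrib_left ..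
    moreover have "c * resid ?I mu f' l x = c * (x l - mu l) + (- c) * (\<Sum>n\<in>?I. gl n (x n))"
      by (simp add: resid_def f'l algebra_simps)
    ultimately show ?thesis unfolding rl[symmetric] unfolding resid_def[of _ _ _ i] f'i by linarith
  qed
  have rm: "resid ?I mu f' m x = resid ?I mu f m x" if "m \<noteq> l" "m \<noteq> i" for m x
    using f'm[OF that] by (simp add: resid_def)
  \<comment> \<open>Only the factors of \<open>i\<close> and \<open>l\<close> change, and their
    product is preserved by the rotation.\<close>
  have jd: "joint_density ?I mu f' s2' x = joint_density ?I mu f s2 x" for x
  proof -
    let ?J = "?I - {i} - {l}"
    have split: "(\<Prod>j\<in>?I. h j) = (h i * h l) * (\<Prod>j\<in>?J. h j)" for h :: "nat \<Rightarrow> real"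
      using prod.remove[of ?I i h] prod.remove[of "?I - {i}" l h] iI lI il by (simp add: mult.assoc)
    have "(\<Prod>j\<in>?J. normal_density 0 (sqrt (s2' j)) (resid ?I mu f' j x)) = (\<Prod>j\<in>?J. normal_density 0 (sqrt (s2 j)) (resid ?I mu f j x))"
      by (intro prod.cong) (auto simp: rm s2'_def simp del: One_nat_def)
    moreover have "normal_density 0 (sqrt (s2' i)) (resid ?I mu f' i x) * normal_density 0 (sqrt (s2' l)) (resid ?I mu f' l x)
      = normal_density 0 (sqrt (s2 i)) (resid ?I mu f i x) * normal_density 0 (sqrt (s2 l)) (resid ?I mu f l x)"
      unfolding rl ri using normal_density_pair_rotate[OF sv w_def, of "resid ?I mu f i x" "resid ?I mu f l x"] il
      by (simp add: s2'_def c_def s_def v_def)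
    ultimately show ?thesis unfolding joint_density_def split by simp
  qed
  have pos': "\<forall>j\<in>?I. 0 < s2' j" using pos sv wp by (simp add: s2'_def)
  have "plsem_law p P mu f' s2'"
    unfolding plsem_law_def jd using pos' f'C f'_mean P by (simp add: has_bochner_integral_iff)
  moreover have "\<forall>m. m \<noteq> l \<longrightarrow> f' m i = f m i" using gi0 z by (simp add: f'_def)
  ultimately show ?thesis using co' by blast
qed

text \<open>Each swap alters, among the functions of \<open>x i\<close>, only the one into the node
  just passed, so the edges to the remaining nodes stay linear.\<close>

lemma move_past_linear_children:
  assumes "plsem_law p P mu f s2" "causal_order (as @ i # ls @ bs) f" "set (as @ i # ls @ bs) = {1..p}"
    and "\<And>l. l \<in> set ls \<Longrightarrow> deriv (deriv (f l i)) = (\<lambda>_. 0)"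
  shows "\<exists>f' s2'. plsem_law p P mu f' s2' \<and> causal_order (as @ ls @ i # bs) f'"
  using assms
proof (induction ls arbitrary: as f s2)
  case Nil
  then show ?case by auto
next
  case (Cons l ls)
  obtain f' s2' where f': "plsem_law p P mu f' s2'" "causal_order (as @ l # i # ls @ bs) f'" "\<And>m. m \<noteq> l \<Longrightarrow> f' m i = f m i"
    using swap_linear_neighbours[of p P mu f s2 as i l "ls @ bs"] Cons.prems by auto
  have "l \<notin> set ls" using Cons.prems(2) by (auto simp: causal_order_def)
  then have "deriv (deriv (f' m i)) = (\<lambda>_. 0)" if "m \<in> set ls" for m
    using that f'(3)[of m] Cons.prems(4)[of m] by (cases "m = l") auto
  then have "\<exists>f' s2'. plsem_law p P mu f' s2' \<and> causal_order ((as @ [l]) @ ls @ i # bs) f'"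
    using Cons.prems(3) f'(1,2) by (intro Cons.IH) auto
  then show ?case by simp
qed

text \<open>The causal order used is \<open>A\<close>, \<open>i\<close>, \<open>L\<close>,
  \<open>N\<close>: non-descendants of \<open>i\<close>, then \<open>i\<close>, then descendants not
  reached through a nonlinear child, then those that are. Once \<open>i\<close> has moved behind
  \<open>L\<close>, the node \<open>k\<close> precedes it.\<close>

theorem equivalent_plsem_without_descendant:
  assumes gen: "generates p P D mu f sigma2" and i: "i \<in> {1..p}" and k: "k \<in> {1..p}" "k \<noteq> i"
    and no: "\<nexists>j. D i j \<and> nonlinear (f j i) \<and> descendant D j k"
  shows "\<exists>D' mu' f' sigma2'. generates p P D' mu' f' sigma2' \<and> \<not> descendant D' i k"
proof -
  have dag: "is_dag p D" using gen by (simp add: generates_def)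
  have nodes: "u \<in> {1..p} \<and> v \<in> {1..p}" if "D u v" for u v using dag that unfolding is_dag_def by blast
  have acyc: "\<not> D\<^sup>+\<^sup>+ u u" for u using dag by (simp add: is_dag_def)
  define N where "N = {m. \<exists>j. D i j \<and> nonlinear (f j i) \<and> descendant D j m}"
  define L where "L = {m. D\<^sup>+\<^sup>+ i m} - N"
  define A where "A = {m\<in>{1..p}. \<not> D\<^sup>*\<^sup>* i m}"
  have N_desc: "D\<^sup>+\<^sup>+ i m" if "m \<in> N" for m
    using that by (auto simp: N_def descendant_def dest: rtranclp_into_tranclp2)
  have desc_node: "m \<in> {1..p}" if "D\<^sup>+\<^sup>+ i m" for m
    using that by (cases rule: tranclp.cases) (use nodes in blast)+
  then have fin: "finite N" "finite L" "finite A"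
    using N_desc by (auto simp: L_def A_def intro!: finite_subset[of _ "{1..p}"])
  obtain as where as: "distinct as" "set as = A" "sorted_wrt (\<lambda>a b. \<not> D b a) as"
    using topological_sort[OF dag fin(3)] by blast
  obtain ls where ls: "distinct ls" "set ls = L" "sorted_wrt (\<lambda>a b. \<not> D b a) ls"
    using topological_sort[OF dag fin(2)] by blast
  obtain bs where bs: "distinct bs" "set bs = N" "sorted_wrt (\<lambda>a b. \<not> D b a) bs"
    using topological_sort[OF dag fin(1)] by blast
  \<comment> \<open>Closure of \<open>N\<close> under edges is what allows \<open>L\<close> to come
    before \<open>N\<close>.\<close>
  have NN: "v \<in> N" if "u \<in> N" "D u v" for u v
    using that unfolding N_def descendant_def by (auto intro: rtranclp.rtrancl_into_rtrancl)
  have c1: "\<not> D b a" if "a \<in> A" "b = i \<or> b \<in> L \<or> b \<in> N" for a b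
  proof
    assume "D b a"
    have "D\<^sup>*\<^sup>* i b" using that(2) N_desc by (auto simp: L_def intro: tranclp_into_rtranclp)
    then have "D\<^sup>*\<^sup>* i a" using \<open>D b a\<close> by (rule rtranclp.rtrancl_into_rtrancl)
    then show False using that(1) by (simp add: A_def)
  qed
  have c2: "\<not> D b i" if "b \<in> L \<or> b \<in> N" for b
    using that N_desc acyc[of i] by (auto simp: L_def dest: tranclp.trancl_into_trancl)
  have c3: "\<not> D b a" if "a \<in> L" "b \<in> N" for a b
    using that NN by (auto simp: L_def)
  have iA: "i \<notin> A" "i \<notin> L" "i \<notin> N" using acyc[of i] N_desc by (auto simp: A_def L_def)
  have disj: "A \<inter> L = {}" "A \<inter> N = {}" "L \<inter> N = {}"
    using N_desc by (auto simp: A_def L_def dest: tranclp_into_rtranclp)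
  have sets: "set (as @ i # ls @ bs) = {1..p}"
  proof -
    have "m = i \<or> D\<^sup>+\<^sup>+ i m" if "D\<^sup>*\<^sup>* i m" for m using that by (metis rtranclpD)
    then have "{1..p} \<subseteq> insert i (A \<union> L \<union> N)" by (auto simp: A_def L_def)
    moreover have "insert i (A \<union> L \<union> N) \<subseteq> {1..p}" using i desc_node N_desc by (auto simp: A_def L_def)
    ultimately show ?thesis using as ls bs by auto
  qed
  have "distinct (as @ i # ls @ bs)" using as ls bs iA disj by auto
  moreover have "sorted_wrt (\<lambda>a b. \<not> D b a) (as @ i # ls @ bs)"
    using as ls bs c1 c2 c3 by (auto simp: sorted_wrt_append)
  ultimately have co: "causal_order (as @ i # ls @ bs) (edge_fun D f)"
    by (rule causal_order_edge_fun[OF dag])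
  \<comment> \<open>A nonlinear child is its own descendant, hence in \<open>N\<close> and not in
    \<open>L\<close>.\<close>
  have lin: "deriv (deriv (edge_fun D f l i)) = (\<lambda>_. 0)" if "l \<in> set ls" for l
  proof (cases "D i l")
    case True
    then have "\<not> nonlinear (f l i)" using that ls by (auto simp: L_def N_def descendant_def)
    then show ?thesis using True by (simp add: edge_fun_def nonlinear_def)
  qed (simp add: edge_fun_def)
  obtain f' s2' where law': "plsem_law p P mu f' s2'" and co': "causal_order (as @ ls @ i # bs) f'"
    using move_past_linear_children[OF generates_imp_plsem_law[OF gen] co sets lin] by blast
  let ?xs = "as @ ls @ i # bs"
  have xs: "set ?xs = {1..p}" using sets by auto
  have gen': "generates p P (support_graph p f') mu f' s2'"
    by (rule plsem_law_imp_generates[OF law' co' xs])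
  have "\<not> descendant (support_graph p f') i k"
  proof
    assume "descendant (support_graph p f') i k"
    then have desc: "(support_graph p f')\<^sup>+\<^sup>+ i k" using k(2) unfolding descendant_def by (metis rtranclpD)
    have "a \<in> set ?xs \<and> b \<in> set ?xs \<and> f' b a \<noteq> (\<lambda>_. 0)" if "support_graph p f' a b" for a b
      using that unfolding support_graph_def xs by blast
    from causal_order_tranclp[OF co' this desc]
    obtain m n where mn: "m < n" "n < length ?xs" "?xs ! m = i" "?xs ! n = k" by blast
    have d: "distinct ?xs" using co' by (simp add: causal_order_def)
    have "?xs ! length (as @ ls) = i" by (simp add: nth_append)
    then have "m = length (as @ ls)" using mn d nth_eq_iff_index_eq[OF d, of m "length (as @ ls)"] by simp
    moreover have "k \<in> set (as @ ls)"
    proof -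
      have "k \<notin> N" using no by (auto simp: N_def)
      moreover have "k \<in> set (as @ i # ls @ bs)" using k(1) sets by blast
      ultimately show ?thesis using k(2) bs(2) by simp
    qed
    then obtain n' where "n' < length (as @ ls)" "(as @ ls) ! n' = k" unfolding in_set_conv_nth by blast
    moreover from this have "?xs ! n' = k" using nth_append[of "as @ ls" "i # bs" n'] by simp
    ultimately have "n' < m" "?xs ! n' = ?xs ! n" using mn(4) by simp_all
    then show False using mn(1,2) nth_eq_iff_index_eq[OF d, of n' n] by simp
  qed
  then show ?thesis using gen' by blast
qed

section \<open>Conditional independence from noise invariance\<close>

lemma directed_path:
  assumes "D\<^sup>*\<^sup>* j k"
  shows "\<exists>ps. ps \<noteq> [] \<and> hd ps = j \<and> last ps = k \<and> (\<forall>n. Suc n < length ps \<longrightarrow> D (ps ! n) (ps ! Suc n))"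
  using assms
proof (induction rule: converse_rtranclp_induct)
  case base
  then show ?case by (intro exI[of _ "[k]"]) auto
next
  case (step j j')
  then obtain ps where ps: "ps \<noteq> []" "hd ps = j'" "last ps = k" "\<And>n. Suc n < length ps \<Longrightarrow> D (ps ! n) (ps ! Suc n)"
    by blast
  have "D ((j # ps) ! n) ((j # ps) ! Suc n)" if "Suc n < length (j # ps)" for n
    using that ps step(1) by (cases n) (auto simp: hd_conv_nth)
  then show ?case using ps by (intro exI[of _ "j # ps"]) auto
qed

text \<open>A directed path from \<open>j\<close> to \<open>k\<close> has no collider in an acyclic
  graph, and all its nodes are descendants of \<open>j\<close>, hence outside \<open>C\<close>;
  nothing blocks it.\<close>

lemma descendants_not_d_separated:
  assumes dag: "is_dag p D" and j: "j \<in> {1..p}" and jk: "D\<^sup>*\<^sup>* j k" and C: "\<And>c. c \<in> C \<Longrightarrow> \<not> D\<^sup>*\<^sup>* j c"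
  shows "\<not> d_separated p D {j} {k} C"
proof -
  obtain ps where ps: "ps \<noteq> []" "hd ps = j" "last ps = k"
    and edge: "\<And>n. Suc n < length ps \<Longrightarrow> D (ps ! n) (ps ! Suc n)"
    using directed_path[OF jk] by blast
  have acyc: "\<not> D\<^sup>+\<^sup>+ u u" for u using dag by (simp add: is_dag_def)
  have nodes: "u \<in> {1..p} \<and> v \<in> {1..p}" if "D u v" for u v using dag that unfolding is_dag_def by blast
  have path: "D\<^sup>+\<^sup>+ (ps ! m) (ps ! n)" if "m < n" "n < length ps" for m n
    using that
  proof (induction n)
    case (Suc n)
    have e: "D (ps ! n) (ps ! Suc n)" using edge Suc.prems by blast
    show ?case
    proof (cases "m = n")
      case False
      then have "D\<^sup>+\<^sup>+ (ps ! m) (ps ! n)" using Suc by simp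
      then show ?thesis using e by (rule tranclp.trancl_into_trancl)
    qed (use e in auto)
  qed simp
  have desc: "D\<^sup>*\<^sup>* j (ps ! n)" if "n < length ps" for n
    using path[of 0 n] that ps by (cases "n = 0") (auto simp: hd_conv_nth dest: tranclp_into_rtranclp)
  \<comment> \<open>A repeated node would close a directed cycle.\<close>
  have "distinct ps"
    unfolding distinct_conv_nth using path acyc by (metis linorder_neqE_nat)
  moreover have "set ps \<subseteq> {1..p}"
  proof
    fix u assume "u \<in> set ps"
    then obtain n where n: "n < length ps" "ps ! n = u" by (auto simp: in_set_conv_nth)
    then have "u = j \<or> (\<exists>v. D v u)" using desc[OF n(1)] by (metis rtranclp.cases)
    then show "u \<in> {1..p}" using j nodes by blast
  qed
  ultimately have "is_path p D ps" using ps edge by (auto simp: is_path_def adjacent_def)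
  moreover have "\<not> blocked D ps C"
  proof
    assume "blocked D ps C"
    then obtain n where n: "0 < n" "Suc n < length ps"
      and b: "(\<not> collider D ps n \<and> ps ! n \<in> C) \<or> (collider D ps n \<and> (\<forall>w \<in> C. \<not> descendant D (ps ! n) w))"
      unfolding blocked_def by blast
    have "\<not> D (ps ! Suc n) (ps ! n)"
      using edge[OF n(2)] acyc by (meson tranclp.r_into_trancl tranclp.trancl_into_trancl)
    then have "ps ! n \<in> C" using b by (auto simp: collider_def)
    then show False using C desc n(2) by (meson Suc_lessD)
  qed
  ultimately show ?thesis using ps by (auto simp: d_separated_def)
qed

text \<open>The coordinates in \<open>C\<close> and \<open>X k\<close> do not depend on the noise of
  \<open>j\<close>, so they are independent of it. Given \<open>C\<close>, the variable
  \<open>X j\<close> is that noise shifted by a known amount, and \<open>X k\<close> adds no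
  information.\<close>

lemma cond_indep_of_noise_invariant:
  assumes pos: "\<forall>j\<in>{1..p}. 0 < s2 j"
    and X: "X \<in> measurable (PiM {1..p} (\<lambda>_. borel)) (PiM {1..p} (\<lambda>_. borel))"
    and P: "P = distr (noise_space p s2) (PiM {1..p} (\<lambda>_. borel)) X"
    and jI: "j \<in> {1..p}" and kI: "k \<in> {1..p}" and CI: "C \<subseteq> {1..p}"
    and h: "h \<in> borel_measurable (PiM C (\<lambda>_. borel))"
    and Xj: "\<And>e. X e j = h (restrict (X e) C) + e j"
    and inv: "\<And>e t c. c \<in> insert k C \<Longrightarrow> X (e(j := t)) c = X e c"
  shows "cond_indep P {j} {k} C"
proof -
  let ?I = "{1..p}"
  let ?N = "normal_noise s2 j" and ?F = "coord_sigma P C"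
  interpret Ns: prob_space "noise_space p s2" by (rule prob_space_noise_space[OF pos])
  interpret N: prob_space ?N by (rule prob_space_normal_noise) (use pos jI in auto)
  interpret PN: product_sigma_finite "normal_noise s2" by (rule product_sigma_finite_normal_noise)
  have Xm: "X \<in> measurable (noise_space p s2) (PiM ?I (\<lambda>_. borel))"
    using X unfolding noise_space_def by (simp cong: measurable_cong_sets add: sets_PiM_normal_noise)
  interpret P: prob_space P unfolding P by (rule Ns.prob_space_distr[OF Xm])
  have setsP: "sets P = sets (PiM ?I (\<lambda>_. borel))" and spaceP: "space P = space (PiM ?I (\<lambda>_. borel))"
    by (simp_all add: P)
  have rC: "(\<lambda>x. restrict x C) \<in> measurable P (PiM C (\<lambda>_. borel))"
    using measurable_restrict_subset[OF CI, of "\<lambda>_. borel :: real measure"] by (simp cong: measurable_cong_sets add: setsP)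
  have rCF: "(\<lambda>x. restrict x C) \<in> measurable ?F (PiM C (\<lambda>_. borel))"
    unfolding coord_sigma_def using measurable_space[OF rC] by (intro measurable_vimage_algebra1) auto
  have setsF: "sets ?F = {(\<lambda>x. restrict x C) -` A \<inter> space P | A. A \<in> sets (PiM C (\<lambda>_. borel))}"
    unfolding coord_sigma_def using measurable_space[OF rC] by (intro sets_vimage_algebra2) auto
  have sub: "subalgebra P ?F"
    unfolding subalgebra_def setsF using measurable_sets[OF rC] by (auto simp: coord_sigma_def)
  interpret F: finite_measure_subalgebra P ?F by standard (rule sub)
  \<comment> \<open>Candidate for the conditional expectation of \<open>s (x j)\<close> given
    \<open>C\<close>: the noise of \<open>j\<close> is averaged out.\<close>
  define \<psi> where "\<psi> s x = (\<integral>t. s (h (restrict x C) + t) \<partial>?N)" for s :: "real \<Rightarrow> real" and x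
  have \<psi>_bound: "\<bar>\<psi> s x\<bar> \<le> 1" and \<psi>_meas: "\<psi> s \<in> borel_measurable ?F" "\<psi> s \<in> borel_measurable P"
    if s: "s \<in> borel_measurable borel" "\<And>t. \<bar>s t\<bar> \<le> 1" for s x
  proof -
    have "(\<lambda>t. s (c + t)) \<in> borel_measurable ?N" for c using s(1) by measurable
    then have int: "integrable ?N (\<lambda>t. s (c + t))" for c
      using s(2) by (intro N.integrable_const_bound[where B=1]) auto
    have "\<psi> s x \<le> 1" unfolding \<psi>_def
      by (rule N.integral_le_const[OF int]) (use s(2) in \<open>auto intro: order_trans[OF abs_ge_self]\<close>)
    moreover have "- 1 \<le> \<psi> s x" unfolding \<psi>_def
      by (rule N.integral_ge_const[OF int]) (use s(2) in \<open>auto simp: abs_le_iff minus_le_iff\<close>)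
    ultimately show "\<bar>\<psi> s x\<bar> \<le> 1" by simp
    have "(\<lambda>(z, t). s (h z + t)) \<in> borel_measurable (PiM C (\<lambda>_. borel) \<Otimes>\<^sub>M borel)"
      using s(1) h unfolding case_prod_beta' by measurable
    then have "(\<lambda>(z, t). s (h z + t)) \<in> borel_measurable (PiM C (\<lambda>_. borel) \<Otimes>\<^sub>M ?N)"
      by (simp cong: measurable_cong_sets)
    then have *: "(\<lambda>z. \<integral>t. s (h z + t) \<partial>?N) \<in> borel_measurable (PiM C (\<lambda>_. borel))"
      by (rule N.borel_measurable_lebesgue_integral)
    show "\<psi> s \<in> borel_measurable ?F" "\<psi> s \<in> borel_measurable P"
      unfolding \<psi>_def[abs_def] using measurable_compose[OF rCF *] measurable_compose[OF rC *] by auto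
  qed
  have restrict_inv: "restrict (X (e(j := t))) C = restrict (X e) C" for e t
    using inv by (intro restrict_ext) auto
  \<comment> \<open>Fubini with the noise of \<open>j\<close> innermost.\<close>
  have integral_split: "(\<integral>x. g x \<partial>P) = (\<integral>e. (\<integral>t. g (X (e(j := t))) \<partial>?N) \<partial>PiM (?I - {j}) (normal_noise s2))"
    if g: "g \<in> borel_measurable P" "\<And>x. \<bar>g x\<bar> \<le> 1" for g :: "(nat \<Rightarrow> real) \<Rightarrow> real"
  proof -
    have gP: "g \<in> borel_measurable (PiM ?I (\<lambda>_. borel))" using g(1) by (simp cong: measurable_cong_sets add: setsP)
    have I: "insert j (?I - {j}) = ?I" using jI by auto
    have "integrable (noise_space p s2) (\<lambda>e. g (X e))"
      using g(2) measurable_compose[OF Xm gP] by (intro Ns.integrable_const_bound[where B=1]) auto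
    then have "integrable (PiM (insert j (?I - {j})) (normal_noise s2)) (\<lambda>e. g (X e))"
      unfolding noise_space_def I .
    then have "(\<integral>e. g (X e) \<partial>PiM (insert j (?I - {j})) (normal_noise s2)) = (\<integral>e. (\<integral>t. g (X (e(j := t))) \<partial>?N) \<partial>PiM (?I - {j}) (normal_noise s2))"
      by (intro PN.product_integral_insert) auto
    then show ?thesis unfolding P integral_distr[OF Xm gP] unfolding noise_space_def I .
  qed
  \<comment> \<open>A weight \<open>B\<close> that ignores the noise of \<open>j\<close> is constant
    in the inner integral, where \<open>s (x j)\<close> averages to \<open>\<psi> s\<close>.\<close>
  have key: "(\<integral>x. B x * s (x j) \<partial>P) = (\<integral>x. B x * \<psi> s x \<partial>P)"
    if B: "B \<in> borel_measurable P" "\<And>x. \<bar>B x\<bar> \<le> 1" "\<And>e t. B (X (e(j := t))) = B (X e)"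
      and s: "s \<in> borel_measurable borel" "\<And>t. \<bar>s t\<bar> \<le> 1" for B s
  proof -
    have sj: "(\<lambda>x. s (x j)) \<in> borel_measurable P"
      using measurable_PiM_coordinate[OF jI s(1)] by (simp cong: measurable_cong_sets add: setsP)
    have bnd: "\<bar>a * b\<bar> \<le> 1" if "\<bar>a\<bar> \<le> 1" "\<bar>b\<bar> \<le> 1" for a b :: real
      using mult_mono[OF that] by (simp add: abs_mult)
    have "(\<integral>x. B x * s (x j) \<partial>P) = (\<integral>e. (\<integral>t. B (X (e(j := t))) * s (X (e(j := t)) j) \<partial>?N) \<partial>PiM (?I - {j}) (normal_noise s2))"
      using B(1,2) sj s(2) bnd by (intro integral_split) auto
    also have "\<dots> = (\<integral>e. (\<integral>t. B (X (e(j := t))) * \<psi> s (X (e(j := t))) \<partial>?N) \<partial>PiM (?I - {j}) (normal_noise s2))"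
    proof (rule Bochner_Integration.integral_cong[OF refl])
      fix e
      have "X (e(j := t)) j = h (restrict (X e) C) + t" for t
        using Xj[of "e(j := t)"] by (simp add: restrict_inv)
      then have "(\<integral>t. B (X (e(j := t))) * s (X (e(j := t)) j) \<partial>?N) = B (X e) * \<psi> s (X e)"
        by (simp add: B(3) \<psi>_def)
      also have "\<dots> = (\<integral>t. B (X (e(j := t))) * \<psi> s (X (e(j := t))) \<partial>?N)"
        using N.prob_space by (simp add: B(3) \<psi>_def restrict_inv)
      finally show "(\<integral>t. B (X (e(j := t))) * s (X (e(j := t)) j) \<partial>?N) = (\<integral>t. B (X (e(j := t))) * \<psi> s (X (e(j := t))) \<partial>?N)" .
    qed
    also have "\<dots> = (\<integral>x. B x * \<psi> s x \<partial>P)"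
      using B(1,2) \<psi>_meas(2)[OF s] \<psi>_bound[OF s] bnd by (intro integral_split[symmetric]) auto
    finally show ?thesis .
  qed
  show ?thesis
    unfolding cond_indep_def
  proof (intro ballI)
    fix S T assume S: "S \<in> sets (PiM {j} (\<lambda>_. borel :: real measure))" and T: "T \<in> sets (PiM {k} (\<lambda>_. borel :: real measure))"
    \<comment> \<open>\<open>S\<close> consists of functions on \<open>{j}\<close>; \<open>s\<close>
      turns its indicator into a function of one real variable.\<close>
    define s where "s t = (indicator S (\<lambda>i\<in>{j}. t) :: real)" for t
    define q where "q y = (indicator T (restrict y {k}) :: real)" for y :: "nat \<Rightarrow> real"
    have "(\<lambda>t. \<lambda>i\<in>{j}. t) \<in> measurable borel (PiM {j} (\<lambda>_. borel :: real measure))"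
      by (intro measurable_restrict) auto
    then have s: "s \<in> borel_measurable borel" "\<And>t. \<bar>s t\<bar> \<le> 1"
      unfolding s_def[abs_def] using S by (auto intro: measurable_compose borel_measurable_indicator simp: indicator_def)
    have u: "indicator S (restrict y {j}) = s (y j)" for y
    proof -
      have "restrict y {j} = (\<lambda>i\<in>{j}. y j)" by auto
      then show ?thesis by (simp add: s_def)
    qed
    have sj: "(\<lambda>x. s (x j)) \<in> borel_measurable P"
      using measurable_PiM_coordinate[OF jI s(1)] by (simp cong: measurable_cong_sets add: setsP)
    have "(\<lambda>x. restrict x {k}) \<in> measurable P (PiM {k} (\<lambda>_. borel))"
      using measurable_restrict_subset[of "{k}" ?I "\<lambda>_. borel :: real measure"] kI by (simp cong: measurable_cong_sets add: setsP)
    then have q: "q \<in> borel_measurable P" "\<And>y. \<bar>q y\<bar> \<le> 1"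
      unfolding q_def[abs_def] using T by (auto intro: measurable_compose borel_measurable_indicator simp: indicator_def)
    have "restrict (X (e(j := t))) {k} = restrict (X e) {k}" for e t
      using inv by (intro restrict_ext) auto
    then have qinv: "q (X (e(j := t))) = q (X e)" for e t by (simp add: q_def)
    note \<psi>m = \<psi>_meas[OF s] and \<psi>b = \<psi>_bound[OF s]
    have bnd: "\<bar>a * b\<bar> \<le> 1" if "\<bar>a\<bar> \<le> 1" "\<bar>b\<bar> \<le> 1" for a b :: real
      using mult_mono[OF that] by (simp add: abs_mult)
    have int: "integrable P g" if "g \<in> borel_measurable P" "\<And>x. \<bar>g x\<bar> \<le> 1" for g :: "(nat \<Rightarrow> real) \<Rightarrow> real"
      using that by (intro P.integrable_const_bound[where B=1]) auto
    \<comment> \<open>An event of the conditioning algebra depends on the \<open>C\<close>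
      coordinates alone, so its indicator can be absorbed into the weight.\<close>
    have set_key: "(\<integral>x\<in>A. B x * s (x j) \<partial>P) = (\<integral>x\<in>A. B x * \<psi> s x \<partial>P)"
      if A: "A \<in> sets ?F" and B: "B \<in> borel_measurable P" "\<And>x. \<bar>B x\<bar> \<le> 1" "\<And>e t. B (X (e(j := t))) = B (X e)" for A B
    proof -
      obtain A' where A': "A' \<in> sets (PiM C (\<lambda>_. borel))" "A = (\<lambda>x. restrict x C) -` A' \<inter> space P"
        using A unfolding setsF by blast
      define B' where "B' x = (indicator A' (restrict x C) :: real) * B x" for x
      have B'm: "B' \<in> borel_measurable P"
        unfolding B'_def[abs_def]
        by (intro borel_measurable_times B(1) measurable_compose[OF rC borel_measurable_indicator[OF A'(1)]])
      have B'b: "\<bar>B' x\<bar> \<le> 1" for x using B(2)[of x] by (simp add: B'_def indicator_def)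
      have B'i: "B' (X (e(j := t))) = B' (X e)" for e t by (simp add: B'_def restrict_inv B(3))
      have "(\<integral>x\<in>A. B x * g x \<partial>P) = (\<integral>x. B' x * g x \<partial>P)" for g
        unfolding set_lebesgue_integral_def
        by (intro Bochner_Integration.integral_cong) (auto simp: B'_def A'(2) indicator_def)
      then show ?thesis using key[OF B'm B'b B'i s] by simp
    qed
    have Cs: "AE x in P. real_cond_exp P ?F (\<lambda>y. s (y j)) x = \<psi> s x"
    proof (rule F.real_cond_exp_charact[OF _ int[OF sj s(2)] int[OF \<psi>m(2) \<psi>b] \<psi>m(1)])
      fix A assume "A \<in> sets ?F"
      from set_key[OF this, of "\<lambda>_. 1"] show "(\<integral>x\<in>A. s (x j) \<partial>P) = (\<integral>x\<in>A. \<psi> s x \<partial>P)" by simp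
    qed
    \<comment> \<open>\<open>\<psi> s\<close> is measurable for the conditioning algebra and pulls
      out; \<open>q\<close> ignores the noise of \<open>j\<close>, so \<open>set_key\<close> applies
      with \<open>B = q\<close>.\<close>
    have Csq: "AE x in P. real_cond_exp P ?F (\<lambda>y. s (y j) * q y) x = \<psi> s x * real_cond_exp P ?F q x"
    proof (rule F.real_cond_exp_charact)
      have i\<psi>q: "integrable P (\<lambda>x. \<psi> s x * q x)" 
        by (intro int borel_measurable_times \<psi>m(2) q(1) bnd \<psi>b q(2))
      show "integrable P (\<lambda>x. s (x j) * q x)"
        by (intro int borel_measurable_times sj q(1) bnd s(2) q(2))
      show "(\<lambda>x. \<psi> s x * real_cond_exp P ?F q x) \<in> borel_measurable ?F"
        by (intro borel_measurable_times \<psi>m(1) borel_measurable_cond_exp)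
      show "integrable P (\<lambda>x. \<psi> s x * real_cond_exp P ?F q x)"
        by (rule F.real_cond_exp_intg(1)[OF i\<psi>q \<psi>m(1) q(1)])
      fix A assume A: "A \<in> sets ?F"
      then have A\<psi>: "(\<lambda>x. indicator A x * \<psi> s x) \<in> borel_measurable ?F" using \<psi>m(1) by measurable
      have AP: "A \<in> sets P" using A sub by (auto simp: subalgebra_def)
      have iA: "integrable P (\<lambda>x. indicator A x * \<psi> s x * q x)"
        using integrable_mult_indicator[OF AP i\<psi>q] by (simp add: mult.assoc)
      have "(\<integral>x\<in>A. s (x j) * q x \<partial>P) = (\<integral>x\<in>A. q x * s (x j) \<partial>P)" by (simp add: mult.commute)
      also have "\<dots> = (\<integral>x\<in>A. q x * \<psi> s x \<partial>P)" by (rule set_key[OF A q qinv])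
      also have "\<dots> = (\<integral>x. indicator A x * \<psi> s x * q x \<partial>P)" by (simp add: set_lebesgue_integral_def mult_ac)
      also have "\<dots> = (\<integral>x. indicator A x * \<psi> s x * real_cond_exp P ?F q x \<partial>P)"
        by (rule F.real_cond_exp_intg(2)[OF iA A\<psi> q(1), symmetric])
      also have "\<dots> = (\<integral>x\<in>A. \<psi> s x * real_cond_exp P ?F q x \<partial>P)" by (simp add: set_lebesgue_integral_def mult_ac)
      finally show "(\<integral>x\<in>A. s (x j) * q x \<partial>P) = (\<integral>x\<in>A. \<psi> s x * real_cond_exp P ?F q x \<partial>P)" .
    qed
    show "AE x in P.
          real_cond_exp P ?F (\<lambda>y. indicator S (restrict y {j}) * indicator T (restrict y {k})) x
          = real_cond_exp P ?F (\<lambda>y. indicator S (restrict y {j})) x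
            * real_cond_exp P ?F (\<lambda>y. indicator T (restrict y {k})) x"
      unfolding u q_def[symmetric] using Cs Csq by eventually_elim simp
  qed
qed

section \<open>Descendants of nonlinear children\<close>

text \<open>The residuals of \<open>D'\<close> outside the descendants of \<open>i\<close> are constant in \<open>x i\<close>. Their expressions
  in the residuals of \<open>D\<close> must then avoid \<open>j\<close>, since \<open>x i\<close> enters the latter through the linearly
  independent second derivatives.\<close>
lemma nondescendant_invariant_under_noise:
  assumes gen: "generates p P D mu f s2" and gen': "generates p P D' mu' f' s2'"
    and i: "i \<in> {1..p}"
    and lin: "lin_indep_family {j. D i j \<and> nonlinear (f j i)} (\<lambda>j. deriv (deriv (f j i)))"
    and j: "D i j" "nonlinear (f j i)" and k: "k \<in> {1..p}" "\<not> descendant D' i k"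
    and r: "\<And>b. b \<in> {1..p} \<Longrightarrow> b \<noteq> j \<Longrightarrow> resid {1..p} mu (edge_fun D f) b x = resid {1..p} mu (edge_fun D f) b y"
  shows "x k = y k"
proof -
  let ?I = "{1..p}"
  let ?r = "resid ?I mu (edge_fun D f)" and ?g = "resid ?I mu' (edge_fun D' f')"
  let ?J = "{j. D i j \<and> nonlinear (f j i)}"
  have dag: "is_dag p D" and dag': "is_dag p D'"
    using gen gen' unfolding generates_def by blast+
  have nodes: "u \<in> ?I \<and> v \<in> ?I" if "D u v" for u v using dag that unfolding is_dag_def by blast
  have nodes': "u \<in> ?I \<and> v \<in> ?I" if "D' u v" for u v using dag' that unfolding is_dag_def by blast
  define A where "A = {m\<in>?I. \<not> descendant D' i m}"
  \<comment> \<open>\<open>A\<close> is ancestral in \<open>D'\<close>, so its residuals determine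
    its coordinates.\<close>
  have closed: "a \<in> A" if "m \<in> A" "D' a m" for a m
    using that nodes' by (auto simp: A_def descendant_def intro: rtranclp.rtrancl_into_rtrancl)
  have g_eq: "?g l x = ?g l y" if l: "l \<in> A" for l
  proof -
    have lI: "l \<in> ?I" and li: "l \<noteq> i" and nD: "\<not> D' i l"
      using l by (auto simp: A_def descendant_def)
    obtain w where w: "\<And>x. ?g l x = (\<Sum>b\<in>?I. w b * ?r b x)"
      using resid_linear_dependence[OF gen gen' lI] by blast
    define F where "F b = edge_fun D f b i" for b
    have C: "C2 (F b)" for b unfolding F_def by (rule C2_edge_fun[OF gen])
    \<comment> \<open>The combination is evaluated on the line through the zero vector in direction
      \<open>i\<close>, where the residual of \<open>l\<close> in \<open>D'\<close> is constant;
      \<open>if b = i then 0 else 0\<close> is the coordinate term at the base point.\<close>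
    have FF: "(\<Sum>b\<in>?I. w b * (((if b = i then t else 0) - F b t) - ((if b = i then 0 else 0) - F b 0))) = 0" for t
    proof -
      let ?z = "\<lambda>_::nat. 0 :: real"
      have "?g l (?z(i := t)) = ?g l ?z"
        using nD li by (subst resid_fun_upd[OF finite_atLeastAtMost i]) (simp add: edge_fun_def)
      moreover have "?r b (?z(i := t)) = ?r b ?z + (((if b = i then t else 0) - F b t) - ((if b = i then 0 else 0) - F b 0))" for b
        unfolding F_def by (rule resid_fun_upd[OF finite_atLeastAtMost i])
      ultimately show ?thesis unfolding w by (simp add: distrib_left sum.distrib)
    qed
    have d1: "((\<lambda>t. \<Sum>b\<in>?I. w b * (((if b = i then t else 0) - F b t) - ((if b = i then 0 else 0) - F b 0)))
       has_real_derivative (\<Sum>b\<in>?I. w b * ((if b = i then 1 else 0) - deriv (F b) t))) (at t)" for t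
    proof (intro DERIV_sum DERIV_cmult)
      fix b show "((\<lambda>t. ((if b = i then t else 0) - F b t) - ((if b = i then 0 else 0) - F b 0)) has_real_derivative (if b = i then 1 else 0) - deriv (F b) t) (at t)"
        by (auto intro!: derivative_eq_intros C2_derivs(1)[OF C])
    qed
    have FF1: "(\<Sum>b\<in>?I. w b * ((if b = i then 1 else 0) - deriv (F b) t)) = 0" for t
      using DERIV_unique[OF d1[of t, unfolded FF] DERIV_const] .
    have d2: "((\<lambda>t. \<Sum>b\<in>?I. w b * ((if b = i then 1 else 0) - deriv (F b) t))
       has_real_derivative (\<Sum>b\<in>?I. w b * (- deriv (deriv (F b)) t))) (at t)" for t
    proof (intro DERIV_sum DERIV_cmult)
      fix b show "((\<lambda>t. (if b = i then 1 else 0) - deriv (F b) t) has_real_derivative - deriv (deriv (F b)) t) (at t)"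
        by (auto intro!: derivative_eq_intros C2_derivs(2)[OF C])
    qed
    have FF2: "(\<Sum>b\<in>?I. w b * (- deriv (deriv (F b)) t)) = 0" for t
      using DERIV_unique[OF d2[of t, unfolded FF1] DERIV_const] .
    \<comment> \<open>Second derivatives vanish except at nonlinear children, so the identity
      becomes one about the linearly independent family.\<close>
    have "(\<Sum>b\<in>?J. w b * deriv (deriv (f b i)) t) = 0" for t
    proof -
      have "(\<Sum>b\<in>?J. w b * deriv (deriv (f b i)) t) = (\<Sum>b\<in>?I. w b * deriv (deriv (F b)) t)"
        using nodes by (intro sum.mono_neutral_cong_left) (auto simp: F_def edge_fun_def nonlinear_def simp del: One_nat_def)
      also have "\<dots> = 0" using FF2[of t] by (simp add: sum_negf)
      finally show ?thesis .
    qed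
    then have "\<forall>b\<in>?J. w b = 0" using lin unfolding lin_indep_family_def by blast
    then have wj: "w j = 0" using j by blast
    have "w b * ?r b x = w b * ?r b y" if "b \<in> ?I" for b
      using r[OF that] wj by (cases "b = j") auto
    then show ?thesis unfolding w by (intro sum.cong) auto
  qed
  have kA: "k \<in> A" and AI: "A \<subseteq> ?I" using k by (auto simp: A_def)
  show ?thesis
    by (rule resid_determines[OF dag', where A=A and mu=mu' and f=f']) (fact AI kA g_eq | erule closed, assumption)+
qed

text \<open>By contradiction: otherwise \<open>X k\<close> ignores the noise of \<open>j\<close>,
  giving a conditional independence that faithfulness turns into a false d-separation.\<close>

theorem descendant_of_nonlinear_child:
  assumes gen: "generates p P D mu f s2" and faith: "faithful p P D"
    and gen': "generates p P D' mu' f' s2'"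
    and i: "i \<in> {1..p}" and k: "k \<in> {1..p}"
    and lin: "lin_indep_family {j. D i j \<and> nonlinear (f j i)} (\<lambda>j. deriv (deriv (f j i)))"
    and j: "D i j" "nonlinear (f j i)" and jk: "descendant D j k"
  shows "descendant D' i k"
proof (rule ccontr)
  assume nd: "\<not> descendant D' i k"
  let ?I = "{1..p}"
  let ?r = "resid ?I mu (edge_fun D f)"
  have dag: "is_dag p D" and pos: "\<forall>j\<in>?I. 0 < s2 j" using gen unfolding generates_def by blast+
  have nodes: "u \<in> ?I \<and> v \<in> ?I" if "D u v" for u v using dag that unfolding is_dag_def by blast
  have acyc: "\<not> D\<^sup>+\<^sup>+ u u" for u using dag by (simp add: is_dag_def)
  have jI: "j \<in> ?I" using nodes j by blast
  obtain X where X: "X \<in> measurable (PiM ?I (\<lambda>_. borel)) (PiM ?I (\<lambda>_. borel))"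
    and rX: "\<And>e b. b \<in> ?I \<Longrightarrow> ?r b (X e) = e b"
    and PX: "P = distr (noise_space p s2) (PiM ?I (\<lambda>_. borel)) X"
    using generates_solution[OF gen] by metis
  \<comment> \<open>\<open>C\<close> contains all parents of \<open>j\<close>, so \<open>X j\<close>
    is a function of \<open>C\<close> plus its own noise, and no descendant of \<open>j\<close>, so
    directed paths from \<open>j\<close> to \<open>k\<close> stay open.\<close>
  define C where "C = {c\<in>?I. \<not> D\<^sup>*\<^sup>* j c}"
  have C_closed: "a \<in> C" if "c \<in> C" "D a c" for a c
    using that nodes by (auto simp: C_def intro: rtranclp.rtrancl_into_rtrancl)
  have C_inv: "X (e(j := t)) c = X e c" if "c \<in> C" for e t c
    by (rule resid_determines[OF dag _ C_closed _ that, where mu=mu and f=f])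
       (auto simp: C_def rX simp del: One_nat_def)
  have k_inv: "X (e(j := t)) k = X e k" for e t
    by (rule nondescendant_invariant_under_noise[OF gen gen' i lin j k nd]) (simp add: rX del: One_nat_def)
  have parents: "a \<in> C" if "D a j" for a
    using that nodes acyc[of a] by (auto simp: C_def dest: rtranclp_into_tranclp2)
  define h where "h z = mu j + (\<Sum>a\<in>C. edge_fun D f j a (z a))" for z
  have CI: "C \<subseteq> ?I" by (auto simp: C_def)
  have hm: "h \<in> borel_measurable (PiM C (\<lambda>_. borel))"
    unfolding h_def[abs_def]
    by (intro borel_measurable_add borel_measurable_sum borel_measurable_const measurable_PiM_coordinate
        C2_measurable C2_edge_fun[OF gen])
  have Xj: "X e j = h (restrict (X e) C) + e j" for e
  proof -
    have "(\<Sum>a\<in>C. edge_fun D f j a (restrict (X e) C a)) = (\<Sum>a\<in>?I. edge_fun D f j a (X e a))"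
      using CI parents by (intro sum.mono_neutral_cong_left) (auto simp: edge_fun_def simp del: One_nat_def)
    then show ?thesis using rX[OF jI, of e] by (simp add: h_def resid_def)
  qed
  \<comment> \<open>Raising the noise of \<open>j\<close> by one raises \<open>X j\<close> by one
    but leaves \<open>X k\<close> fixed.\<close>
  have "k \<noteq> j"
  proof
    assume "k = j"
    define e where "e = (\<lambda>_::nat. 0 :: real)"
    have "restrict (X (e(j := 1))) C = restrict (X e) C" using C_inv by (intro restrict_ext) auto
    then have "X (e(j := 1)) j = X e j + 1" using Xj[of e] Xj[of "e(j := 1)"] by (simp add: e_def)
    then show False using k_inv[of e 1] \<open>k = j\<close> by simp
  qed
  have "X (e(j := t)) c = X e c" if "c \<in> insert k C" for e t c
    using that C_inv k_inv by blast
  then have "cond_indep P {j} {k} C"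
    by (rule cond_indep_of_noise_invariant[OF pos X PX jI k CI hm Xj])
  \<comment> \<open>Both are descendants of \<open>j\<close>, so the three sets are disjoint as
    faithfulness requires.\<close>
  moreover have "j \<notin> C" "k \<notin> C" using jk by (auto simp: C_def descendant_def)
  then have "cond_indep P {j} {k} C \<longleftrightarrow> d_separated p D {j} {k} C"
    using jI k CI \<open>k \<noteq> j\<close> by (intro faith[unfolded faithful_def, rule_format]) simp
  ultimately have "d_separated p D {j} {k} C" by (rule iffD1[rotated])
  moreover have "\<not> d_separated p D {j} {k} C"
    using jk by (intro descendants_not_d_separated[OF dag jI]) (auto simp: C_def descendant_def)
  ultimately show False by contradiction
qed

theorem mainTheorem6:
  fixes p :: nat and P :: "(nat \<Rightarrow> real) measure"
    and D :: "nat \<Rightarrow> nat \<Rightarrow> bool" and mu :: "nat \<Rightarrow> real"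
    and f :: "nat \<Rightarrow> nat \<Rightarrow> real \<Rightarrow> real" and sigma2 :: "nat \<Rightarrow> real"
    and i k :: nat
  assumes gen: "generates p P D mu f sigma2"
    and faith: "faithful p P D"
    and i_node: "i \<in> {1..p}"
    and k_node: "k \<in> {1..p}"
    and lin: "lin_indep_family {j. D i j \<and> nonlinear (f j i)} (\<lambda>j. deriv (deriv (f j i)))"
    and ki: "k \<noteq> i"
  shows "(\<forall>D' mu' f' sigma2'. generates p P D' mu' f' sigma2' \<longrightarrow> descendant D' i k)
         \<longleftrightarrow> (\<exists>j. D i j \<and> nonlinear (f j i) \<and> descendant D j k)"
proof
  assume "\<forall>D' mu' f' sigma2'. generates p P D' mu' f' sigma2' \<longrightarrow> descendant D' i k"
  then show "\<exists>j. D i j \<and> nonlinear (f j i) \<and> descendant D j k"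
    using equivalent_plsem_without_descendant[OF gen i_node k_node ki] by blast
next
  assume "\<exists>j. D i j \<and> nonlinear (f j i) \<and> descendant D j k"
  then show "\<forall>D' mu' f' sigma2'. generates p P D' mu' f' sigma2' \<longrightarrow> descendant D' i k"
    using descendant_of_nonlinear_child[OF gen faith _ i_node k_node lin] by blast
qed

end
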